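(* Let $A$ be a finite set, $n\in\mathbb{N}$, and $\varepsilon,r>0$. For any $\mu\in\Pr(A^n)$ there exists a fuzzy partition $(\rho_1,\dots,\rho_k)$ on $A^n$ such that (a) $\mathrm{I}_\mu(\rho_1,\dots,\rho_k)\le 2\,\mathrm{DTC}(\mu)$; (b) $\langle\rho_1\rangle<\varepsilon$; and (c) $\langle\rho_j\rangle>0$ and the measure $\mu_{|\rho_j}$ satisfies $\mathrm{T}(rn/200,r)$ for every $j=2,3,\dots,k$.
   Context: $\langle\cdot\rangle$ denotes integration with respect to $\mu$. A fuzzy partition on $A^n$ is a tuple $(\rho_1,\dots,\rho_k)$ of functions $A^n\to[0,1]$ with $\rho_1+\dots+\rho_k=1$. For $\rho\ge0$ with $\langle\rho\rangle>0$, $\mu_{|\rho}:=\rho\mu/\langle\rho\rangle$. $\mathrm{I}_\mu(\rho_1,\dots,\rho_k)$ is the mutual information $\mathrm{I}(\xi;\zeta)$ for a random pair $(\zeta,\xi)\in[k]\times A^n$ with $\mathbb{P}(\zeta=j,\xi=\mathbf x)=\rho_j(\mathbf x)\mu(\mathbf x)$; equivalently $\sum_j\langle\rho_j\rangle\mathrm{D}(\mu_{|\rho_j}\|\mu)$. If $\xi=(\xi_1,\dots,\xi_n)$ has law $\mu$, the dual total correlation is $\mathrm{DTC}(\mu)=\mathrm{H}(\xi)-\sum_{i=1}^n\mathrm{H}(\xi_i\,|\,\xi_{[n]\setminus\{i\}})$. $A^n$ carries the normalized Hamming metric $d_n(\mathbf a,\mathbf a')=|\{i:a_i\ne a_i'\}|/n$;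 $\overline{d_n}$ is the associated transportation metric (infimum over couplings of $\int d_n$); $\mathrm{D}$ is KL divergence; a measure $\mu$ satisfies $\mathrm{T}(\kappa,r)$ if $\overline{d_n}(\nu,\mu)\le\frac1\kappa\mathrm{D}(\nu\|\mu)+r$ for all $\nu\in\Pr(A^n)$. *)

theory Defs
  imports Complex_Main "HOL-Library.FuncSet"
begin

text \<open>The product space A^n, with A the (finite) universe of the type 'a;
points are functions on {..<n} (extensional: undefined outside).\<close>
definition cube :: "nat \<Rightarrow> (nat \<Rightarrow> 'a) set" where
  "cube n = PiE {..<n} (\<lambda>_. UNIV)"

definition is_prob :: "nat \<Rightarrow> ((nat \<Rightarrow> 'a) \<Rightarrow> real) \<Rightarrow> bool" where
  "is_prob n \<mu> \<longleftrightarrow> (\<forall>x\<in>cube n. 0 \<le> \<mu> x) \<and> (\<Sum>x\<in>cube n. \<mu> x) = 1"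

definition integ :: "nat \<Rightarrow> ((nat \<Rightarrow> 'a) \<Rightarrow> real) \<Rightarrow> ((nat \<Rightarrow> 'a) \<Rightarrow> real) \<Rightarrow> real" where
  "integ n \<mu> f = (\<Sum>x\<in>cube n. f x * \<mu> x)"

definition cond_meas :: "nat \<Rightarrow> ((nat \<Rightarrow> 'a) \<Rightarrow> real) \<Rightarrow> ((nat \<Rightarrow> 'a) \<Rightarrow> real) \<Rightarrow> (nat \<Rightarrow> 'a) \<Rightarrow> real" where
  "cond_meas n \<mu> \<rho> x = \<rho> x * \<mu> x / integ n \<mu> \<rho>"

definition fuzzy_partition :: "nat \<Rightarrow> nat \<Rightarrow> (nat \<Rightarrow> (nat \<Rightarrow> 'a) \<Rightarrow> real) \<Rightarrow> bool" where
  "fuzzy_partition n k \<rho> \<longleftrightarrow> 1 \<le> k \<and>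
     (\<forall>j\<in>{1..k}. \<forall>x\<in>cube n. 0 \<le> \<rho> j x \<and> \<rho> j x \<le> 1) \<and>
     (\<forall>x\<in>cube n. (\<Sum>j=1..k. \<rho> j x) = 1)"

text \<open>Mutual information I(xi;zeta) for the joint law P(zeta=j, xi=x) = rho_j(x) mu(x),
  natural logarithm, convention 0 ln 0 = 0.\<close>
definition mutual_info :: "nat \<Rightarrow> ((nat \<Rightarrow> 'a) \<Rightarrow> real) \<Rightarrow> nat \<Rightarrow> (nat \<Rightarrow> (nat \<Rightarrow> 'a) \<Rightarrow> real) \<Rightarrow> real" where
  "mutual_info n \<mu> k \<rho> =
     (\<Sum>j\<in>{1..k}. \<Sum>x\<in>cube n.
        (let p = \<rho> j x * \<mu> x;
             pz = (\<Sum>y\<in>cube n. \<rho> j y * \<mu> y);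
             px = (\<Sum>i\<in>{1..k}. \<rho> i x * \<mu> x)
         in if p = 0 then 0 else p * ln (p / (pz * px))))"

definition marginal :: "nat \<Rightarrow> ((nat \<Rightarrow> 'a) \<Rightarrow> real) \<Rightarrow> nat set \<Rightarrow> (nat \<Rightarrow> 'a) \<Rightarrow> real" where
  "marginal n \<mu> S y = (\<Sum>x\<in>{x\<in>cube n. restrict x S = y}. \<mu> x)"

definition entropy :: "nat \<Rightarrow> ((nat \<Rightarrow> 'a) \<Rightarrow> real) \<Rightarrow> real" where
  "entropy n \<mu> = - (\<Sum>x\<in>cube n. if \<mu> x = 0 then 0 else \<mu> x * ln (\<mu> x))"

definition cond_entropy_coord :: "nat \<Rightarrow> ((nat \<Rightarrow> 'a) \<Rightarrow> real) \<Rightarrow> nat \<Rightarrow> real" where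
  "cond_entropy_coord n \<mu> i =
     - (\<Sum>x\<in>cube n. if \<mu> x = 0 then 0
          else \<mu> x * ln (\<mu> x / marginal n \<mu> ({..<n} - {i}) (restrict x ({..<n} - {i}))))"

definition DTC :: "nat \<Rightarrow> ((nat \<Rightarrow> 'a) \<Rightarrow> real) \<Rightarrow> real" where
  "DTC n \<mu> = entropy n \<mu> - (\<Sum>i<n. cond_entropy_coord n \<mu> i)"

definition hamming :: "nat \<Rightarrow> (nat \<Rightarrow> 'a) \<Rightarrow> (nat \<Rightarrow> 'a) \<Rightarrow> real" where
  "hamming n a b = real (card {i\<in>{..<n}. a i \<noteq> b i}) / real n"

definition is_coupling :: "nat \<Rightarrow> ((nat \<Rightarrow> 'a) \<Rightarrow> real) \<Rightarrow> ((nat \<Rightarrow> 'a) \<Rightarrow> real)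
    \<Rightarrow> ((nat \<Rightarrow> 'a) \<times> (nat \<Rightarrow> 'a) \<Rightarrow> real) \<Rightarrow> bool" where
  "is_coupling n \<nu> \<mu> \<pi> \<longleftrightarrow> (\<forall>p\<in>cube n \<times> cube n. 0 \<le> \<pi> p) \<and>
     (\<forall>a\<in>cube n. (\<Sum>b\<in>cube n. \<pi> (a, b)) = \<nu> a) \<and>
     (\<forall>b\<in>cube n. (\<Sum>a\<in>cube n. \<pi> (a, b)) = \<mu> b)"

definition dbar :: "nat \<Rightarrow> ((nat \<Rightarrow> 'a) \<Rightarrow> real) \<Rightarrow> ((nat \<Rightarrow> 'a) \<Rightarrow> real) \<Rightarrow> real" where
  "dbar n \<nu> \<mu> = Inf {(\<Sum>p\<in>cube n \<times> cube n. \<pi> p * hamming n (fst p) (snd p)) | \<pi>. is_coupling n \<nu> \<mu> \<pi>}"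

text \<open>KL divergence D(nu||mu), finite case (nu absolutely continuous w.r.t. mu).\<close>
definition abs_cont :: "nat \<Rightarrow> ((nat \<Rightarrow> 'a) \<Rightarrow> real) \<Rightarrow> ((nat \<Rightarrow> 'a) \<Rightarrow> real) \<Rightarrow> bool" where
  "abs_cont n \<nu> \<mu> \<longleftrightarrow> (\<forall>x\<in>cube n. \<mu> x = 0 \<longrightarrow> \<nu> x = 0)"

definition KL :: "nat \<Rightarrow> ((nat \<Rightarrow> 'a) \<Rightarrow> real) \<Rightarrow> ((nat \<Rightarrow> 'a) \<Rightarrow> real) \<Rightarrow> real" where
  "KL n \<nu> \<mu> = (\<Sum>x\<in>cube n. if \<nu> x = 0 then 0 else \<nu> x * ln (\<nu> x / \<mu> x))"

text \<open>Transportation inequality T(kappa, r). When nu is not absolutely continuous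
  w.r.t. mu, D(nu||mu) = +infinity and the inequality holds trivially.\<close>
definition transport_ineq :: "nat \<Rightarrow> ((nat \<Rightarrow> 'a) \<Rightarrow> real) \<Rightarrow> real \<Rightarrow> real \<Rightarrow> bool" where
  "transport_ineq n \<mu> \<kappa> r \<longleftrightarrow>
     (\<forall>\<nu>. is_prob n \<nu> \<and> abs_cont n \<nu> \<mu> \<longrightarrow> dbar n \<nu> \<mu> \<le> KL n \<nu> \<mu> / \<kappa> + r)"

end

theory Submission
  imports Defs "HOL-Analysis.Function_Topology"
begin

text \<open>
  If a measure violates \<open>T(\<kappa>, r)\<close> with \<open>\<kappa> = rn/200\<close>, Kantorovich duality and the Gibbs variational
  principle give a 1-Lipschitz \<open>f\<close> whose log-Laplace transform at \<open>\<kappa>\<close> is too large, and the mean value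
  theorem gives some \<open>t \<le> \<kappa>\<close> for which the tilted measure proportional to \<open>exp (t f) m\<close> has relative
  entropy at least \<open>100 t\<^sup>2 / n\<close>. Splitting off a small multiple of this tilt yields mutual information of
  that order per unit of mass, while each of the \<open>n\<close> conditional mutual informations with a single
  coordinate is only \<open>O(t\<^sup>2 / n\<^sup>2)\<close>, because \<open>t f\<close> varies by at most \<open>t / n\<close> along a coordinate. Hence the
  split lowers the average DTC by at least half of the information it reveals. As long as the violating
  pieces have total mass at least \<open>\<epsilon>\<close>, splitting all of them lowers the average DTC by a fixed positive
  amount; since DTC is nonnegative this stops after finitely many rounds. The remaining violating pieces
  are merged into the first piece, which does not increase the information.
\<close>

section \<open>Entropy functionals\<close>

lemma finite_cube [simp]: "finite (cube n :: (nat \<Rightarrow> 'a::finite) set)"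
  unfolding cube_def by (intro finite_PiE) auto

lemma cube_nonempty [simp]: "cube n \<noteq> {}"
  unfolding cube_def by (simp add: PiE_eq_empty_iff)

lemma fun_upd_in_cube: "x \<in> cube n \<Longrightarrow> i < n \<Longrightarrow> x(i := a) \<in> cube n"
  unfolding cube_def by (auto simp: PiE_def extensional_def)

lemma cube_eqI: "x \<in> cube n \<Longrightarrow> y \<in> cube n \<Longrightarrow> (\<And>i. i < n \<Longrightarrow> x i = y i) \<Longrightarrow> x = y"
  unfolding cube_def by (rule PiE_ext) auto

text \<open>The pieces of a fuzzy partition are handled as unnormalised measures \<open>m = \<rho>\<^sub>j \<mu>\<close>. The functionals
  below are the usual ones for the normalisation of \<open>m\<close>, multiplied by the mass of \<open>m\<close> (and by \<open>-1\<close>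
  for the entropies). The mutual information of a fuzzy partition then is the sum of \<open>neg_ent\<close>
  over its pieces minus \<open>neg_ent\<close> of \<open>\<mu>\<close>.\<close>

definition mass :: "nat \<Rightarrow> ((nat \<Rightarrow> 'a) \<Rightarrow> real) \<Rightarrow> real" where
  "mass n m = (\<Sum>x\<in>cube n. m x)"

definition neg_ent :: "nat \<Rightarrow> ((nat \<Rightarrow> 'a) \<Rightarrow> real) \<Rightarrow> real" where
  "neg_ent n m = (\<Sum>x\<in>cube n. m x * ln (m x / mass n m))"

text \<open>The marginal of \<open>m\<close> on the coordinates other than \<open>i\<close>, kept as
  a function on the whole cube that ignores \<open>x i\<close>.\<close>

definition fibre_mass :: "nat \<Rightarrow> ((nat \<Rightarrow> 'a) \<Rightarrow> real) \<Rightarrow> (nat \<Rightarrow> 'a) \<Rightarrow> real" where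
  "fibre_mass i m x = (\<Sum>a\<in>UNIV. m (x(i := a)))"

definition neg_cond_ent :: "nat \<Rightarrow> nat \<Rightarrow> ((nat \<Rightarrow> 'a) \<Rightarrow> real) \<Rightarrow> real" where
  "neg_cond_ent n i m = (\<Sum>x\<in>cube n. m x * ln (m x / fibre_mass i m x))"

definition dtc_mass :: "nat \<Rightarrow> ((nat \<Rightarrow> 'a) \<Rightarrow> real) \<Rightarrow> real" where
  "dtc_mass n m = (\<Sum>i<n. neg_cond_ent n i m) - neg_ent n m"

definition nonneg_on :: "nat \<Rightarrow> ((nat \<Rightarrow> 'a) \<Rightarrow> real) \<Rightarrow> bool" where
  "nonneg_on n m \<longleftrightarrow> (\<forall>x\<in>cube n. 0 \<le> m x)"

text \<open>The map sending \<open>(x, a)\<close> to \<open>(x(i := a), x i)\<close> is an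
  involution that exchanges a point with its update. It moves a fibre sum from one factor of a
  product to the other.\<close>

lemma sum_cube_fibre_swap:
  fixes G :: "(nat \<Rightarrow> 'a::finite) \<Rightarrow> (nat \<Rightarrow> 'a) \<Rightarrow> real"
  assumes "i < n"
  shows "(\<Sum>x\<in>cube n. \<Sum>a\<in>UNIV. G x (x(i := a))) = (\<Sum>x\<in>cube n. \<Sum>a\<in>UNIV. G (x(i := a)) x)"
  unfolding sum.cartesian_product
  by (rule sum.reindex_bij_witness
      [of _ "\<lambda>(x, a). (x(i := a), x i)" "\<lambda>(x, a). (x(i := a), x i)"])
    (auto intro: fun_upd_in_cube[OF _ assms])

text \<open>Termwise \<open>p ln (p / q) \<ge> p - q\<close>, from \<open>ln z \<le> z - 1\<close>.
  The total masses are merely compared, because competitors \<open>q\<close> built later may lose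
  mass where a denominator vanishes.\<close>

lemma gibbs_inequality:
  fixes p q :: "'b \<Rightarrow> real"
  assumes "finite S" and p: "\<And>x. x \<in> S \<Longrightarrow> 0 \<le> p x" and q: "\<And>x. x \<in> S \<Longrightarrow> 0 \<le> q x"
    and ac: "\<And>x. x \<in> S \<Longrightarrow> 0 < p x \<Longrightarrow> 0 < q x" and le: "sum q S \<le> sum p S"
  shows "0 \<le> (\<Sum>x\<in>S. p x * ln (p x / q x))"
proof -
  have "p x - q x \<le> p x * ln (p x / q x)" if x: "x \<in> S" for x
  proof (cases "p x = 0")
    case False
    then have pos: "0 < p x" "0 < q x" using p[OF x] ac[OF x] by auto
    have "ln (q x / p x) \<le> q x / p x - 1" using pos by (intro ln_le_minus_one) simp
    then have "1 - q x / p x \<le> ln (p x / q x)" using pos by (simp add: ln_div)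
    then have "p x * (1 - q x / p x) \<le> p x * ln (p x / q x)" using pos by (simp add: mult_left_mono)
    then show ?thesis using pos by (simp add: algebra_simps)
  qed (use q x in auto)
  then have "(\<Sum>x\<in>S. p x - q x) \<le> (\<Sum>x\<in>S. p x * ln (p x / q x))" by (rule sum_mono)
  then show ?thesis using le by (simp add: sum_subtractf)
qed

lemma fibre_mass_ge:
  fixes m :: "(nat \<Rightarrow> 'a::finite) \<Rightarrow> real"
  assumes "nonneg_on n m" "x \<in> cube n" "i < n"
  shows "m x \<le> fibre_mass i m x"
proof -
  have "m (x(i := x i)) \<le> (\<Sum>a\<in>UNIV. m (x(i := a)))"
    by (rule member_le_sum) (use assms in \<open>auto simp: nonneg_on_def intro: fun_upd_in_cube\<close>)
  then show ?thesis by (simp add: fibre_mass_def)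
qed

lemma mass_ge:
  fixes m :: "(nat \<Rightarrow> 'a::finite) \<Rightarrow> real"
  assumes "nonneg_on n m" "x \<in> cube n"
  shows "m x \<le> mass n m"
  unfolding mass_def by (rule member_le_sum) (use assms in \<open>auto simp: nonneg_on_def\<close>)

lemma mass_nonneg: "nonneg_on n m \<Longrightarrow> 0 \<le> mass n m"
  unfolding mass_def nonneg_on_def by (auto intro: sum_nonneg)

section \<open>Marginals of initial segments and the chain rule\<close>

definition prefix_mass :: "nat \<Rightarrow> nat \<Rightarrow> ((nat \<Rightarrow> 'a) \<Rightarrow> real) \<Rightarrow> (nat \<Rightarrow> 'a) \<Rightarrow> real" where
  "prefix_mass n i m x = (\<Sum>y\<in>{y\<in>cube n. \<forall>k<i. y k = x k}. m y)"

lemma prefix_mass_0: "prefix_mass n 0 m x = mass n m"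
  by (simp add: prefix_mass_def mass_def)

lemma prefix_mass_n: "x \<in> cube n \<Longrightarrow> prefix_mass n n m x = m x"
proof -
  assume "x \<in> cube n"
  then have "{y\<in>cube n. \<forall>k<n. y k = x k} = {x}" by (auto intro: cube_eqI)
  then show ?thesis by (simp add: prefix_mass_def)
qed

lemma prefix_mass_upd: "prefix_mass n i m (x(i := a)) = prefix_mass n i m x"
  unfolding prefix_mass_def by (rule sum.cong) auto

lemma prefix_mass_ge:
  fixes m :: "(nat \<Rightarrow> 'a::finite) \<Rightarrow> real"
  assumes "nonneg_on n m" "x \<in> cube n"
  shows "m x \<le> prefix_mass n i m x"
  unfolding prefix_mass_def by (rule member_le_sum) (use assms in \<open>auto simp: nonneg_on_def\<close>)

lemma prefix_mass_nonneg:
  assumes "nonneg_on n m" shows "0 \<le> prefix_mass n i m x"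
  unfolding prefix_mass_def by (rule sum_nonneg) (use assms in \<open>auto simp: nonneg_on_def\<close>)

lemma sum_prefix_mass_Suc:
  fixes m :: "(nat \<Rightarrow> 'a::finite) \<Rightarrow> real"
  shows "(\<Sum>a\<in>UNIV. prefix_mass n (Suc i) m (x(i := a))) = prefix_mass n i m x"
proof -
  let ?S = "{y\<in>cube n. \<forall>k<i. y k = x k}"
  have "prefix_mass n (Suc i) m (x(i := a)) = (\<Sum>y\<in>{y\<in>?S. y i = a}. m y)" for a
    unfolding prefix_mass_def by (rule sum.cong) (auto simp: less_Suc_eq)
  then have "(\<Sum>a\<in>UNIV. prefix_mass n (Suc i) m (x(i := a))) = (\<Sum>a\<in>UNIV. \<Sum>y\<in>{y\<in>?S. y i = a}. m y)"
    by simp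
  also have "\<dots> = (\<Sum>y\<in>?S. m y)" by (rule sum.group) auto
  finally show ?thesis by (simp add: prefix_mass_def)
qed

text \<open>Chain rule: conditioning on all other coordinates lowers the entropy further than
  conditioning on the preceding ones.\<close>
lemma dtc_mass_nonneg:
  fixes m :: "(nat \<Rightarrow> 'a::finite) \<Rightarrow> real"
  assumes m: "nonneg_on n m"
  shows "0 \<le> dtc_mass n m"
proof -
  define P where "P i x = prefix_mass n i m x" for i x
  have pos: "0 < P i x \<and> 0 < mass n m" if "x \<in> cube n" "m x > 0" for i x
    using prefix_mass_ge[OF m that(1), of i] mass_ge[OF m that(1)] that by (simp add: P_def)
  have posf: "0 < fibre_mass i m x" if "x \<in> cube n" "m x > 0" "i < n" for i x
    using fibre_mass_ge[OF m that(1,3)] that by simp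
  have nn: "0 \<le> P i x" for i x by (simp add: P_def prefix_mass_nonneg[OF m])
  have fnn: "0 \<le> fibre_mass i m x" if "i < n" "x \<in> cube n" for i x
    using fibre_mass_ge[OF m that(2,1)] m that by (force simp: nonneg_on_def)
  have step: "(\<Sum>x\<in>cube n. m x * (ln (P (Suc i) x) - ln (P i x))) \<le> neg_cond_ent n i m" if i: "i < n" for i
  proof -
    \<comment> \<open>The marginal of the other coordinates times the conditional law of coordinate
      \<open>i\<close> given only the preceding ones. Gibbs' inequality against \<open>q\<close>
      expresses that further conditioning lowers entropy.\<close>
    define q where "q x = fibre_mass i m x * (P (Suc i) x / P i x)" for x
    have "(\<Sum>x\<in>cube n. q x) = (\<Sum>x\<in>cube n. \<Sum>a\<in>UNIV. m (x(i:=a)) * (P (Suc i) x / P i x))"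
      by (simp add: q_def fibre_mass_def sum_distrib_right sum_divide_distrib)
    also have "\<dots> = (\<Sum>x\<in>cube n. \<Sum>a\<in>UNIV. m x * (P (Suc i) (x(i:=a)) / P i (x(i:=a))))"
      by (rule sum_cube_fibre_swap[OF i, of "\<lambda>x y. m y * (P (Suc i) x / P i x)"])
    also have "\<dots> = (\<Sum>x\<in>cube n. m x * (P i x / P i x))"
      by (intro sum.cong refl) (simp add: P_def prefix_mass_upd sum_prefix_mass_Suc
          flip: sum_divide_distrib sum_distrib_left)
    \<comment> \<open>The quotient is 1, or 0 where the denominator vanishes.\<close>
    also have "\<dots> \<le> (\<Sum>x\<in>cube n. m x)"
    proof (rule sum_mono)
      fix x :: "nat \<Rightarrow> 'a" assume "x \<in> cube n"
      then have "0 \<le> m x" using m by (simp add: nonneg_on_def)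
      then show "m x * (P i x / P i x) \<le> m x" by (cases "P i x = 0") auto
    qed
    finally have "0 \<le> (\<Sum>x\<in>cube n. m x * ln (m x / q x))"
      using m i pos posf nn fnn by (intro gibbs_inequality) (auto simp: nonneg_on_def q_def)
    also have "\<dots> = neg_cond_ent n i m - (\<Sum>x\<in>cube n. m x * (ln (P (Suc i) x) - ln (P i x)))"
      unfolding neg_cond_ent_def sum_subtractf[symmetric]
    proof (rule sum.cong)
      fix x :: "nat \<Rightarrow> 'a" assume x: "x \<in> cube n"
      show "m x * ln (m x / q x) = m x * ln (m x / fibre_mass i m x) - m x * (ln (P (Suc i) x) - ln (P i x))"
      proof (cases "m x = 0")
        case False
        then have mp: "0 < m x" using m x by (auto simp: nonneg_on_def order_less_le)
        then show ?thesis using pos[OF x mp, of i] pos[OF x mp, of "Suc i"] posf[OF x mp i]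
          by (simp add: q_def ln_div ln_mult algebra_simps)
      qed simp
    qed simp
    finally show ?thesis by simp
  qed
  \<comment> \<open>On the cube \<open>P n\<close> is \<open>m\<close> and \<open>P 0\<close> is the
    total mass, so the entropy telescopes over the coordinates.\<close>
  have "neg_ent n m = (\<Sum>x\<in>cube n. m x * (ln (P n x) - ln (P 0 x)))"
    unfolding neg_ent_def
  proof (rule sum.cong)
    fix x :: "nat \<Rightarrow> 'a" assume x: "x \<in> cube n"
    show "m x * ln (m x / mass n m) = m x * (ln (P n x) - ln (P 0 x))"
    proof (cases "m x = 0")
      case False
      then have mp: "0 < m x" using m x by (auto simp: nonneg_on_def order_less_le)
      then show ?thesis using pos[OF x mp, of 0] x
        by (simp add: P_def ln_div prefix_mass_0 prefix_mass_n)
    qed simp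
  qed simp
  also have "\<dots> = (\<Sum>x\<in>cube n. \<Sum>i<n. m x * (ln (P (Suc i) x) - ln (P i x)))"
    by (simp add: sum_lessThan_telescope[of "\<lambda>i. ln (P i x)" for x] flip: sum_distrib_left)
  also have "\<dots> = (\<Sum>i<n. \<Sum>x\<in>cube n. m x * (ln (P (Suc i) x) - ln (P i x)))" by (rule sum.swap)
  also have "\<dots> \<le> (\<Sum>i<n. neg_cond_ent n i m)" by (rule sum_mono) (use step in auto)
  finally show ?thesis by (simp add: dtc_mass_def)
qed

text \<open>This is the relative entropy of the two normalisations, scaled by the mass of
  \<open>m\<close>. Gibbs' inequality applies once \<open>m'\<close> is rescaled to that mass, and
  domination gives absolute continuity.\<close>

lemma rel_ent_nonneg:
  fixes m m' :: "(nat \<Rightarrow> 'a::finite) \<Rightarrow> real"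
  assumes m: "nonneg_on n m" and le: "\<And>x. x \<in> cube n \<Longrightarrow> m x \<le> m' x"
  shows "0 \<le> (\<Sum>x\<in>cube n. m x * (ln (m x / mass n m) - ln (m' x / mass n m')))"
proof -
  have m': "nonneg_on n m'" using m le by (force simp: nonneg_on_def)
  have pos: "0 < mass n m \<and> 0 < mass n m' \<and> 0 < m' x" if "x \<in> cube n" "0 < m x" for x
    using mass_ge[OF m that(1)] mass_ge[OF m' that(1)] le[OF that(1)] that by auto
  have "0 \<le> (\<Sum>x\<in>cube n. m x * ln (m x / (mass n m * (m' x / mass n m'))))"
  proof (rule gibbs_inequality)
    show "0 < mass n m * (m' x / mass n m')" if "x \<in> cube n" "0 < m x" for x
      using pos[OF that] by simp
    show "0 \<le> mass n m * (m' x / mass n m')" if "x \<in> cube n" for x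
      using m' that mass_nonneg[OF m] mass_nonneg[OF m'] by (auto simp: nonneg_on_def)
    have "(\<Sum>x\<in>cube n. mass n m * (m' x / mass n m')) = mass n m * (mass n m' / mass n m')"
      by (simp add: mass_def flip: sum_distrib_left sum_divide_distrib)
    also have "\<dots> \<le> mass n m" using mass_nonneg[OF m] by (cases "mass n m' = 0") auto
    finally show "(\<Sum>x\<in>cube n. mass n m * (m' x / mass n m')) \<le> sum m (cube n)" by (simp add: mass_def)
  qed (use m in \<open>auto simp: nonneg_on_def\<close>)
  also have "\<dots> = (\<Sum>x\<in>cube n. m x * (ln (m x / mass n m) - ln (m' x / mass n m')))"
  proof (rule sum.cong)
    fix x :: "nat \<Rightarrow> 'a" assume x: "x \<in> cube n"
    show "m x * ln (m x / (mass n m * (m' x / mass n m'))) = m x * (ln (m x / mass n m) - ln (m' x / mass n m'))"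
    proof (cases "m x = 0")
      case False
      then have p: "0 < m x" using m x by (auto simp: nonneg_on_def order_less_le)
      then show ?thesis using pos[OF x p] by (simp add: ln_div ln_mult algebra_simps)
    qed simp
  qed simp
  finally show ?thesis .
qed

text \<open>The information gained by a split is the weighted relative entropy of the pieces to the
  whole. The terms in \<open>ln (m x / mass n m)\<close> combine because the pieces sum to
  \<open>m\<close>.\<close>

lemma neg_ent_add:
  fixes m1 m2 m :: "(nat \<Rightarrow> 'a::finite) \<Rightarrow> real"
  assumes "\<And>x. x \<in> cube n \<Longrightarrow> m x = m1 x + m2 x"
  shows "neg_ent n m1 + neg_ent n m2 - neg_ent n m
    = (\<Sum>x\<in>cube n. m1 x * (ln (m1 x / mass n m1) - ln (m x / mass n m)))
    + (\<Sum>x\<in>cube n. m2 x * (ln (m2 x / mass n m2) - ln (m x / mass n m)))"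
  using assms unfolding neg_ent_def
  by (simp add: sum_subtractf[symmetric] sum.distrib[symmetric] algebra_simps)

text \<open>Both relative entropies in \<open>neg_ent_add\<close> are nonnegative; hence merging
  pieces cannot increase information.\<close>

lemma neg_ent_add_le:
  fixes m1 m2 m :: "(nat \<Rightarrow> 'a::finite) \<Rightarrow> real"
  assumes "nonneg_on n m1" "nonneg_on n m2" "\<And>x. x \<in> cube n \<Longrightarrow> m x = m1 x + m2 x"
  shows "neg_ent n m \<le> neg_ent n m1 + neg_ent n m2"
  using neg_ent_add[OF assms(3)] rel_ent_nonneg[OF assms(1), of m] rel_ent_nonneg[OF assms(2), of m]
    assms by (force simp: nonneg_on_def)

section \<open>Kantorovich duality for the Hamming metric\<close>

text \<open>Tychonoff's theorem. Coordinates outside a finite set can be pinned to a singleton, so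
  couplings can stay plain functions.\<close>

lemma compact_box_fun:
  fixes B :: "'b \<Rightarrow> real set"
  assumes "\<And>p. compact (B p)"
  shows "compact {\<pi>. \<forall>p. \<pi> p \<in> B p}"
proof -
  have "compactin (product_topology (\<lambda>_. euclidean) UNIV) (PiE UNIV B)"
    using assms by (simp add: compactin_PiE)
  then have "compact (PiE UNIV B)" by (simp add: euclidean_product_topology)
  then show ?thesis by (simp add: PiE_def Pi_def)
qed

text \<open>The logarithmic barrier keeps the minimiser in the interior of the coupling polytope, so
  stationarity along the moves that swap mass on a rectangle makes \<open>c - \<theta> / \<pi>\<close> split
  as \<open>u + v\<close>; the barrier terms contribute exactly \<open>\<eta>\<close> to the duality gap.\<close>
lemma approx_dual_potentials:
  fixes \<nu> \<mu> :: "'b \<Rightarrow> real" and c :: "'b \<Rightarrow> 'b \<Rightarrow> real"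
  assumes fin: "finite S" "finite T" and \<nu>: "\<And>x. x \<in> S \<Longrightarrow> 0 < \<nu> x" and \<mu>: "\<And>y. y \<in> T \<Longrightarrow> 0 < \<mu> y"
    and sums: "sum \<nu> S = 1" "sum \<mu> T = 1" and c: "\<And>x y. 0 \<le> c x y" and \<eta>: "0 < \<eta>"
  obtains \<pi> u v where "\<And>p. p \<in> S \<times> T \<Longrightarrow> 0 \<le> \<pi> p" "\<And>p. p \<notin> S \<times> T \<Longrightarrow> \<pi> p = 0"
    "\<And>x. x \<in> S \<Longrightarrow> (\<Sum>y\<in>T. \<pi> (x, y)) = \<nu> x" "\<And>y. y \<in> T \<Longrightarrow> (\<Sum>x\<in>S. \<pi> (x, y)) = \<mu> y"
    "\<And>x y. x \<in> S \<Longrightarrow> y \<in> T \<Longrightarrow> u x + v y \<le> c x y"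
    "(\<Sum>p\<in>S\<times>T. \<pi> p * c (fst p) (snd p)) = (\<Sum>x\<in>S. u x * \<nu> x) + (\<Sum>y\<in>T. v y * \<mu> y) + \<eta>"
proof -
  have ne: "S \<noteq> {}" "T \<noteq> {}" using sums by auto
  then obtain x0 y0 where x0: "x0 \<in> S" and y0: "y0 \<in> T" by auto
  define R where "R = S \<times> T"
  have finR: "finite R" and neR: "R \<noteq> {}" using fin ne by (auto simp: R_def)
  \<comment> \<open>Each of the \<open>card R\<close> cells contributes \<open>\<theta>\<close> to
    the duality gap.\<close>
  define \<theta> where "\<theta> = \<eta> / card R"
  have \<theta>: "0 < \<theta>" using \<eta> finR neR by (simp add: \<theta>_def card_gt_0_iff)
  define C where "C p = c (fst p) (snd p)" for p
  define F where "F \<pi> = (\<Sum>p\<in>R. \<pi> p * C p - \<theta> * ln (\<pi> p))" for \<pi> :: "'b \<times> 'b \<Rightarrow> real"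
  \<comment> \<open>The product coupling serves as a strictly positive feasible point.\<close>
  define \<pi>0 where "\<pi>0 p = (if p \<in> R then \<nu> (fst p) * \<mu> (snd p) else 0)" for p
  \<comment> \<open>The first bound makes \<open>\<pi>0\<close> feasible; the second makes a single
    cell at level \<open>\<delta>\<close> cost at least \<open>F \<pi>0 + 1\<close> through the
    barrier.\<close>
  define \<delta> where "\<delta> = min (Min (\<pi>0 ` R)) (exp (- (F \<pi>0 + 1) / \<theta>))"
  have \<pi>0pos: "0 < \<pi>0 p" if "p \<in> R" for p using that \<nu> \<mu> by (auto simp: \<pi>0_def R_def)
  have "0 < Min (\<pi>0 ` R)" using \<pi>0pos finR neR by (subst Min_gr_iff) auto
  then have \<delta>: "0 < \<delta>" by (simp add: \<delta>_def)
  define marg where "marg \<pi> \<longleftrightarrow> (\<forall>x\<in>S. (\<Sum>y\<in>T. \<pi> (x, y)) = \<nu> x) \<and> (\<forall>y\<in>T. (\<Sum>x\<in>S. \<pi> (x, y)) = \<mu> y)"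
    for \<pi> :: "'b \<times> 'b \<Rightarrow> real"
  \<comment> \<open>Coupling weights are at most 1, so the upper end 2 leaves room for
    perturbations.\<close>
  define B where "B p = (if p \<in> R then {\<delta>..2} else {0::real})" for p
  define K where "K = {\<pi>. \<forall>p. \<pi> p \<in> B p} \<inter> {\<pi>. marg \<pi>}"
  have \<nu>1: "\<nu> x \<le> 1" if "x \<in> S" for x
    using member_le_sum[of x S \<nu>] that fin \<nu> sums by (auto intro: less_imp_le)
  have le1: "\<pi> p \<le> 1" if "marg \<pi>" "\<And>p. p \<in> R \<Longrightarrow> 0 \<le> \<pi> p" "p \<in> R" for \<pi> p
  proof -
    obtain x y where p: "p = (x, y)" "x \<in> S" "y \<in> T" using \<open>p \<in> R\<close> by (auto simp: R_def)
    have "\<pi> (x, y) \<le> (\<Sum>y\<in>T. \<pi> (x, y))"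
      by (rule member_le_sum[of y T "\<lambda>y. \<pi> (x, y)"]) (use that(2) p fin in \<open>auto simp: R_def\<close>)
    also have "\<dots> = \<nu> x" using that(1) p by (simp add: marg_def)
    finally show ?thesis using \<nu>1 p by force
  qed
  have marg0: "marg \<pi>0"
    using sums by (auto simp: marg_def \<pi>0_def R_def simp flip: sum_distrib_left sum_distrib_right)
  have "compact K"
  proof -
    have "closed {\<pi>. marg \<pi>}" unfolding marg_def Ball_def
      by (intro closed_Collect_conj closed_Collect_all closed_Collect_imp closed_Collect_eq
          continuous_intros continuous_on_product_coordinates) auto
    moreover have "compact {\<pi>. \<forall>p. \<pi> p \<in> B p}" by (rule compact_box_fun) (simp add: B_def)
    ultimately show ?thesis unfolding K_def by (simp add: compact_Int_closed)
  qed
  moreover have \<pi>0K: "\<pi>0 \<in> K"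
  proof -
    have "\<pi>0 p \<in> B p" for p
    proof (cases "p \<in> R")
      case True
      have "\<delta> \<le> Min (\<pi>0 ` R)" by (simp add: \<delta>_def)
      also have "\<dots> \<le> \<pi>0 p" using True finR by (intro Min_le) auto
      finally have "\<delta> \<le> \<pi>0 p" .
      moreover have "\<pi>0 p \<le> 1" using marg0 \<pi>0pos True by (intro le1) (auto intro: less_imp_le)
      ultimately show ?thesis using True by (simp add: B_def)
    qed (simp add: B_def \<pi>0_def)
    then show ?thesis using marg0 by (simp add: K_def)
  qed
  moreover have "continuous_on K F"
    unfolding F_def
  proof (intro continuous_intros)
    fix p assume "p \<in> R"
    moreover have "\<pi> p \<in> B p" if "\<pi> \<in> K" for \<pi> using that unfolding K_def by blast
    ultimately have "\<delta> \<le> \<pi> p" if "\<pi> \<in> K" for \<pi> using that by (force simp: B_def)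
    then show "\<forall>\<pi>\<in>K. \<pi> p \<noteq> 0" using \<delta> by force
  qed (auto intro: continuous_on_subset[OF continuous_on_product_coordinates])
  ultimately obtain \<pi> where \<pi>K: "\<pi> \<in> K" and min: "\<And>\<pi>'. \<pi>' \<in> K \<Longrightarrow> F \<pi> \<le> F \<pi>'"
    using continuous_attains_inf[of K F] by blast
  have marg: "marg \<pi>" and \<pi>out: "p \<notin> R \<Longrightarrow> \<pi> p = 0" and \<pi>ge: "p \<in> R \<Longrightarrow> \<delta> \<le> \<pi> p" for p
  proof -
    have B: "\<pi> p \<in> B p" and "marg \<pi>" using \<pi>K unfolding K_def by blast+
    then show "marg \<pi>" "p \<notin> R \<Longrightarrow> \<pi> p = 0" "p \<in> R \<Longrightarrow> \<delta> \<le> \<pi> p" by (auto simp: B_def)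
  qed
  have \<pi>pos: "0 < \<pi> p" if "p \<in> R" for p using \<pi>ge[OF that] \<delta> by simp
  have \<pi>1: "\<pi> p \<le> 1" if "p \<in> R" for p using marg \<pi>pos that by (intro le1) (auto intro: less_imp_le)
  have C0: "0 \<le> C p" for p by (simp add: C_def c)
  \<comment> \<open>A cell at the floor would already cost more than \<open>\<pi>0\<close>, while
    all other cells contribute nonnegative amounts since their weights are at most 1.\<close>
  have interior: "\<delta> < \<pi> p" if p: "p \<in> R" for p
  proof (rule ccontr)
    assume "\<not> \<delta> < \<pi> p"
    then have eq: "\<pi> p = \<delta>" using \<pi>ge[OF p] by simp
    have "\<delta> \<le> exp (- (F \<pi>0 + 1) / \<theta>)" by (simp add: \<delta>_def)
    then have "ln \<delta> \<le> ln (exp (- (F \<pi>0 + 1) / \<theta>))" using \<delta> by (subst ln_le_cancel_iff) auto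
    then have "F \<pi>0 + 1 \<le> - (\<theta> * ln \<delta>)" using \<theta> by (simp add: field_simps)
    also have "\<dots> \<le> \<pi> p * C p - \<theta> * ln (\<pi> p)" using eq \<delta> C0[of p] by simp
    also have "\<dots> \<le> F \<pi>" unfolding F_def
    proof (rule member_le_sum[OF p _ finR])
      fix q assume "q \<in> R - {p}"
      then have "ln (\<pi> q) \<le> 0" "0 \<le> \<pi> q" using \<pi>1[of q] \<pi>pos[of q] by auto
      then show "0 \<le> \<pi> q * C q - \<theta> * ln (\<pi> q)"
        using \<theta> C0[of q] by (smt (verit) mult_nonneg_nonneg mult_nonneg_nonpos)
    qed
    finally show False using min[OF \<pi>0K] by simp
  qed
  \<comment> \<open>The partial derivative of \<open>F\<close> in the cell \<open>(x, y)\<close> at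
    the minimiser.\<close>
  define g where "g x y = c x y - \<theta> / \<pi> (x, y)" for x y
  have rect: "g x y - g x y0 - g x0 y + g x0 y0 = 0" if x: "x \<in> S" and y: "y \<in> T" for x y
  proof -
    \<comment> \<open>The product of \<open>\<alpha>\<close> and \<open>\<beta>\<close> adds mass at
      \<open>(x, y)\<close> and \<open>(x0, y0)\<close> and removes it at the other two corners of
      the rectangle, so both marginals are kept.\<close>
    define \<alpha> where "\<alpha> a = (if a = x then 1 else 0) - (if a = x0 then 1 else (0::real))" for a
    define \<beta> where "\<beta> b = (if b = y then 1 else 0) - (if b = y0 then 1 else (0::real))" for b
    define \<chi> where "\<chi> p = (if p \<in> R then \<alpha> (fst p) * \<beta> (snd p) else 0)" for p
    define \<phi> where "\<phi> s = F (\<lambda>p. \<pi> p + s * \<chi> p)" for s :: real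
    have \<chi>1: "\<bar>\<chi> p\<bar> \<le> 1" for p by (auto simp: \<chi>_def \<alpha>_def \<beta>_def)
    have \<alpha>0: "(\<Sum>a\<in>S. k a * \<alpha> a) = k x - k x0" for k
    proof -
      have "k a * \<alpha> a = (if a = x then k a else 0) - (if a = x0 then k a else 0)" for a by (simp add: \<alpha>_def)
      then show ?thesis using x x0 fin by (simp add: sum_subtractf)
    qed
    have \<beta>0: "(\<Sum>b\<in>T. k b * \<beta> b) = k y - k y0" for k
    proof -
      have "k b * \<beta> b = (if b = y then k b else 0) - (if b = y0 then k b else 0)" for b by (simp add: \<beta>_def)
      then show ?thesis using y y0 fin by (simp add: sum_subtractf)
    qed
    define e where "e = min 1 (Min ((\<lambda>p. \<pi> p - \<delta>) ` R))"
    have e: "0 < e" using interior finR neR by (auto simp: e_def)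
    have inK: "(\<lambda>p. \<pi> p + s * \<chi> p) \<in> K" if s: "\<bar>s\<bar> < e" for s
    proof -
      have "\<pi> p + s * \<chi> p \<in> B p" for p
      proof (cases "p \<in> R")
        case True
        have "\<bar>s * \<chi> p\<bar> \<le> \<bar>s\<bar>" using \<chi>1[of p] by (simp add: abs_mult mult_left_le)
        moreover have "e \<le> 1" "e \<le> Min ((\<lambda>p. \<pi> p - \<delta>) ` R)" by (simp_all add: e_def)
        moreover have "Min ((\<lambda>p. \<pi> p - \<delta>) ` R) \<le> \<pi> p - \<delta>" using True finR by (intro Min_le) auto
        ultimately have "\<delta> \<le> \<pi> p + s * \<chi> p" "\<pi> p + s * \<chi> p \<le> 2"
          using s \<pi>1[OF True] by linarith+
        then show ?thesis using True by (simp add: B_def)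
      qed (simp add: B_def \<pi>out \<chi>_def)
      moreover have "marg (\<lambda>p. \<pi> p + s * \<chi> p)"
      proof -
        have "(\<Sum>b\<in>T. \<chi> (a, b)) = 0" if "a \<in> S" for a
          using \<beta>0[of "\<lambda>_. \<alpha> a"] that by (simp add: \<chi>_def R_def)
        moreover have "(\<Sum>a\<in>S. \<chi> (a, b)) = 0" if "b \<in> T" for b
          using \<alpha>0[of "\<lambda>_. \<beta> b"] that by (simp add: \<chi>_def R_def mult.commute)
        ultimately show ?thesis using marg
          by (simp add: marg_def sum.distrib flip: sum_distrib_left)
      qed
      ultimately show ?thesis by (simp add: K_def)
    qed
    have D: "(\<phi> has_real_derivative (\<Sum>p\<in>R. (C p - \<theta> / \<pi> p) * \<chi> p)) (at 0)"
      unfolding \<phi>_def F_def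
      by (rule derivative_eq_intros refl | use \<pi>pos in force)+ (simp add: field_simps)
    have "(\<Sum>p\<in>R. (C p - \<theta> / \<pi> p) * \<chi> p) = 0"
      by (rule DERIV_local_min[OF D e]) (use min inK e in \<open>auto simp: \<phi>_def\<close>)
    moreover have "(\<Sum>p\<in>R. (C p - \<theta> / \<pi> p) * \<chi> p) = (\<Sum>a\<in>S. \<Sum>b\<in>T. g a b * \<alpha> a * \<beta> b)"
      unfolding R_def sum.cartesian_product
      by (rule sum.cong) (auto simp: C_def g_def \<chi>_def R_def)
    moreover have "\<dots> = (\<Sum>a\<in>S. (g a y - g a y0) * \<alpha> a)"
      by (simp add: \<beta>0 left_diff_distrib)
    ultimately show ?thesis by (simp add: \<alpha>0)
  qed
  \<comment> \<open>Vanishing rectangle differences make \<open>g\<close> the sum of a column and a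
    row through the base cell, with the corner value subtracted once.\<close>
  define u where "u x = g x y0" for x
  define v where "v y = g x0 y - g x0 y0" for y
  have split: "u x + v y = g x y" if "x \<in> S" "y \<in> T" for x y
    using rect[OF that] by (simp add: u_def v_def)
  show thesis
  proof (rule that)
    show "0 \<le> \<pi> p" if "p \<in> S \<times> T" for p using \<pi>pos that by (auto simp: R_def intro: less_imp_le)
    show "\<pi> p = 0" if "p \<notin> S \<times> T" for p using \<pi>out that by (auto simp: R_def)
    show "(\<Sum>y\<in>T. \<pi> (x, y)) = \<nu> x" if "x \<in> S" for x using marg that by (simp add: marg_def)
    show "(\<Sum>x\<in>S. \<pi> (x, y)) = \<mu> y" if "y \<in> T" for y using marg that by (simp add: marg_def)
    show "u x + v y \<le> c x y" if "x \<in> S" "y \<in> T" for x y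
      using split[OF that] \<pi>pos[of "(x, y)"] \<theta> that by (simp add: g_def R_def)
    have "(\<Sum>p\<in>R. \<pi> p * c (fst p) (snd p)) = (\<Sum>p\<in>R. \<pi> p * u (fst p) + \<pi> p * v (snd p) + \<theta>)"
    proof (rule sum.cong)
      fix p assume p: "p \<in> R"
      then have "u (fst p) + v (snd p) = c (fst p) (snd p) - \<theta> / \<pi> p"
        using split[of "fst p" "snd p"] by (auto simp: R_def g_def)
      then have "\<pi> p * (u (fst p) + v (snd p)) = \<pi> p * c (fst p) (snd p) - \<theta>"
        using \<pi>pos[OF p] by (simp add: right_diff_distrib)
      then show "\<pi> p * c (fst p) (snd p) = \<pi> p * u (fst p) + \<pi> p * v (snd p) + \<theta>"
        by (simp add: algebra_simps)
    qed simp
    also have "\<dots> = (\<Sum>x\<in>S. \<Sum>y\<in>T. \<pi> (x, y) * u x) + (\<Sum>x\<in>S. \<Sum>y\<in>T. \<pi> (x, y) * v y) + card R * \<theta>"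
      by (simp add: sum.distrib R_def sum.cartesian_product case_prod_beta)
    also have "(\<Sum>x\<in>S. \<Sum>y\<in>T. \<pi> (x, y) * u x) = (\<Sum>x\<in>S. u x * \<nu> x)"
      using marg by (intro sum.cong refl) (simp add: marg_def mult.commute[of "u _"] flip: sum_distrib_right)
    also have "(\<Sum>x\<in>S. \<Sum>y\<in>T. \<pi> (x, y) * v y) = (\<Sum>y\<in>T. v y * \<mu> y)"
      using marg by (subst sum.swap, intro sum.cong refl)
        (simp add: marg_def mult.commute[of "v _"] flip: sum_distrib_right)
    also have "card R * \<theta> = \<eta>" using finR neR by (simp add: \<theta>_def)
    finally show "(\<Sum>p\<in>S\<times>T. \<pi> p * c (fst p) (snd p)) = (\<Sum>x\<in>S. u x * \<nu> x) + (\<Sum>y\<in>T. v y * \<mu> y) + \<eta>"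
      by (simp add: R_def)
  qed
qed

section \<open>Hamming metric and transportation distance\<close>

lemma hamming_nonneg: "0 \<le> hamming n a b" by (simp add: hamming_def)
lemma hamming_self: "hamming n a a = 0" by (simp add: hamming_def)

lemma hamming_triangle: "hamming n a c \<le> hamming n a b + hamming n b c"
proof -
  have "card {i\<in>{..<n}. a i \<noteq> c i} \<le> card ({i\<in>{..<n}. a i \<noteq> b i} \<union> {i\<in>{..<n}. b i \<noteq> c i})"
    by (rule card_mono) auto
  also have "\<dots> \<le> card {i\<in>{..<n}. a i \<noteq> b i} + card {i\<in>{..<n}. b i \<noteq> c i}" by (rule card_Un_le)
  finally show ?thesis
    unfolding hamming_def add_divide_distrib[symmetric] by (intro divide_right_mono) auto
qed

lemma hamming_le_1: "hamming n a b \<le> 1"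
proof -
  have "card {i\<in>{..<n}. a i \<noteq> b i} \<le> card {..<n}" by (rule card_mono) auto
  then show ?thesis by (cases "n = 0") (simp_all add: hamming_def divide_le_eq_1)
qed

lemma hamming_upd: "hamming n x (x(i := a)) \<le> 1 / n"
proof -
  have "card {k\<in>{..<n}. x k \<noteq> (x(i := a)) k} \<le> card {i}" by (rule card_mono) auto
  then show ?thesis by (simp add: hamming_def divide_right_mono)
qed

lemma dbar_le:
  assumes "is_coupling n \<nu> \<mu> \<pi>"
  shows "dbar n \<nu> \<mu> \<le> (\<Sum>p\<in>cube n \<times> cube n. \<pi> p * hamming n (fst p) (snd p))"
  unfolding dbar_def
proof (rule cInf_lower)
  show "bdd_below {(\<Sum>p\<in>cube n \<times> cube n. \<pi> p * hamming n (fst p) (snd p)) | \<pi>. is_coupling n \<nu> \<mu> \<pi>}"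
    by (rule bdd_belowI[of _ 0]) (auto simp: is_coupling_def hamming_nonneg intro!: sum_nonneg mult_nonneg_nonneg)
qed (use assms in auto)

text \<open>The product coupling witnesses the bound. It serves with \<open>b = 1\<close> in general
  and with \<open>b = 0\<close> in dimension zero.\<close>

lemma dbar_le_bound:
  fixes \<nu> \<mu> :: "(nat \<Rightarrow> 'a::finite) \<Rightarrow> real"
  assumes \<nu>: "is_prob n \<nu>" and \<mu>: "is_prob n \<mu>" and b: "\<And>x y :: nat \<Rightarrow> 'a. hamming n x y \<le> b"
  shows "dbar n \<nu> \<mu> \<le> b"
proof -
  let ?\<pi> = "\<lambda>p. \<nu> (fst p) * \<mu> (snd p)"
  have "is_coupling n \<nu> \<mu> ?\<pi>" using \<nu> \<mu>
    by (auto simp: is_coupling_def is_prob_def simp flip: sum_distrib_left sum_distrib_right)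
  then have "dbar n \<nu> \<mu> \<le> (\<Sum>p\<in>cube n \<times> cube n. ?\<pi> p * hamming n (fst p) (snd p))" by (rule dbar_le)
  also have "\<dots> \<le> (\<Sum>p\<in>cube n \<times> cube n. ?\<pi> p * b)"
    using \<nu> \<mu> b by (intro sum_mono mult_left_mono) (auto simp: is_prob_def)
  also have "\<dots> = (\<Sum>x\<in>cube n. \<nu> x) * (\<Sum>y\<in>cube n. \<mu> y) * b"
    by (simp add: sum_product sum.cartesian_product case_prod_beta flip: sum_distrib_right)
  finally show ?thesis using \<nu> \<mu> by (simp add: is_prob_def)
qed

text \<open>Restriction to the supports gives the strictly positive marginals required by the
  barrier. The two potentials are then replaced by one function, the infimal convolution of the
  metric with \<open>- v\<close>, which is 1-Lipschitz and does at least as well.\<close>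

lemma kantorovich_lipschitz_witness:
  fixes \<nu> \<mu> :: "(nat \<Rightarrow> 'a::finite) \<Rightarrow> real"
  assumes \<nu>: "is_prob n \<nu>" and \<mu>: "is_prob n \<mu>" and b: "b < dbar n \<nu> \<mu>"
  obtains f where "\<And>x y. f x - f y \<le> hamming n x y"
    "b < (\<Sum>x\<in>cube n. f x * \<nu> x) - (\<Sum>x\<in>cube n. f x * \<mu> x)"
proof -
  define S where "S = {x\<in>cube n. 0 < \<nu> x}"
  define T where "T = {x\<in>cube n. 0 < \<mu> x}"
  have fin: "finite S" "finite T" by (simp_all add: S_def T_def)
  have \<nu>0: "\<nu> x = 0" if "x \<in> cube n - S" for x using that \<nu> by (force simp: S_def is_prob_def)
  have \<mu>0: "\<mu> x = 0" if "x \<in> cube n - T" for x using that \<mu> by (force simp: T_def is_prob_def)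
  have sumS: "(\<Sum>x\<in>cube n. k x * \<nu> x) = (\<Sum>x\<in>S. k x * \<nu> x)" for k
    by (rule sum.mono_neutral_right) (use \<nu>0 in \<open>auto simp: S_def\<close>)
  have sumT: "(\<Sum>x\<in>cube n. k x * \<mu> x) = (\<Sum>x\<in>T. k x * \<mu> x)" for k
    by (rule sum.mono_neutral_right) (use \<mu>0 in \<open>auto simp: T_def\<close>)
  have s1: "sum \<nu> S = 1" "sum \<mu> T = 1"
    using sumS[of "\<lambda>_. 1"] sumT[of "\<lambda>_. 1"] \<nu> \<mu> by (auto simp: is_prob_def)
  \<comment> \<open>Half of the excess, so the dual value still exceeds \<open>b\<close> after
    \<open>\<eta>\<close> is lost.\<close>
  define \<eta> where "\<eta> = (dbar n \<nu> \<mu> - b) / 2"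
  have \<eta>: "0 < \<eta>" using b by (simp add: \<eta>_def)
  obtain \<pi> u v where \<pi>: "\<And>p. p \<in> S \<times> T \<Longrightarrow> 0 \<le> \<pi> p" "\<And>p. p \<notin> S \<times> T \<Longrightarrow> \<pi> p = 0"
    "\<And>x. x \<in> S \<Longrightarrow> (\<Sum>y\<in>T. \<pi> (x, y)) = \<nu> x" "\<And>y. y \<in> T \<Longrightarrow> (\<Sum>x\<in>S. \<pi> (x, y)) = \<mu> y"
    and uv: "\<And>x y. x \<in> S \<Longrightarrow> y \<in> T \<Longrightarrow> u x + v y \<le> hamming n x y"
    and cost: "(\<Sum>p\<in>S\<times>T. \<pi> p * hamming n (fst p) (snd p)) = (\<Sum>x\<in>S. u x * \<nu> x) + (\<Sum>y\<in>T. v y * \<mu> y) + \<eta>"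
    by (rule approx_dual_potentials[of S T \<nu> \<mu> "hamming n" \<eta>, OF fin _ _ s1 hamming_nonneg \<eta>])
      (auto simp: S_def T_def)
  have "is_coupling n \<nu> \<mu> \<pi>"
    unfolding is_coupling_def
  proof (intro conjI ballI)
    show "0 \<le> \<pi> p" for p using \<pi>(1,2) by (cases "p \<in> S \<times> T") auto
    fix x :: "nat \<Rightarrow> 'a" assume x: "x \<in> cube n"
    have "(\<Sum>y\<in>cube n. \<pi> (x, y)) = (\<Sum>y\<in>T. \<pi> (x, y))"
      by (rule sum.mono_neutral_right) (use \<pi>(2) in \<open>auto simp: T_def\<close>)
    then show "(\<Sum>y\<in>cube n. \<pi> (x, y)) = \<nu> x" using \<pi>(2,3) \<nu>0 x by (cases "x \<in> S") auto
    have "(\<Sum>y\<in>cube n. \<pi> (y, x)) = (\<Sum>y\<in>S. \<pi> (y, x))"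
      by (rule sum.mono_neutral_right) (use \<pi>(2) in \<open>auto simp: S_def\<close>)
    then show "(\<Sum>y\<in>cube n. \<pi> (y, x)) = \<mu> x" using \<pi>(2,4) \<mu>0 x by (cases "x \<in> T") auto
  qed
  then have "dbar n \<nu> \<mu> \<le> (\<Sum>p\<in>cube n \<times> cube n. \<pi> p * hamming n (fst p) (snd p))" by (rule dbar_le)
  also have "\<dots> = (\<Sum>p\<in>S \<times> T. \<pi> p * hamming n (fst p) (snd p))"
    by (rule sum.mono_neutral_right) (use \<pi>(2) in \<open>auto simp: S_def T_def\<close>)
  finally have gap: "b < (\<Sum>x\<in>S. u x * \<nu> x) + (\<Sum>y\<in>T. v y * \<mu> y)"
    using \<eta> unfolding cost \<eta>_def by (simp add: field_simps)
  have T: "T \<noteq> {}" using s1 by auto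
  define f where "f x = Min ((\<lambda>y. hamming n x y - v y) ` T)" for x
  have f_le: "f x \<le> hamming n x y - v y" if "y \<in> T" for x y
    unfolding f_def using fin that by (intro Min_le) auto
  have f_at: "\<exists>y\<in>T. f x = hamming n x y - v y" for x
  proof -
    have "f x \<in> (\<lambda>y. hamming n x y - v y) ` T" unfolding f_def by (rule Min_in) (use fin T in auto)
    then show ?thesis by auto
  qed
  show thesis
  proof (rule that)
    show "f x - f y \<le> hamming n x y" for x y
    proof -
      obtain z where z: "z \<in> T" "f y = hamming n y z - v z" using f_at by blast
      show ?thesis using f_le[OF z(1), of x] z(2) hamming_triangle[of n x z y] by simp
    qed
    \<comment> \<open>On \<open>S\<close>, \<open>u x\<close> lies below every term of the minimum.
      On \<open>T\<close>, the term of the point itself gives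
      \<open>v y \<le> - f y\<close>.\<close>
    have "u x \<le> f x" if "x \<in> S" for x
      using f_at[of x] uv[OF that] by (smt (verit))
    then have "(\<Sum>x\<in>S. u x * \<nu> x) \<le> (\<Sum>x\<in>S. f x * \<nu> x)"
      by (intro sum_mono mult_right_mono) (auto simp: S_def)
    moreover have "(\<Sum>y\<in>T. v y * \<mu> y) \<le> (\<Sum>y\<in>T. - f y * \<mu> y)"
    proof (intro sum_mono mult_right_mono)
      show "v y \<le> - f y" if "y \<in> T" for y using f_le[OF that, of y] by (simp add: hamming_self)
    qed (auto simp: T_def)
    ultimately show "b < (\<Sum>x\<in>cube n. f x * \<nu> x) - (\<Sum>x\<in>cube n. f x * \<mu> x)"
      using gap by (simp add: sumS sumT sum_negf)
  qed
qed

section \<open>Splitting a violating measure\<close>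

text \<open>For negative \<open>y = - z\<close> this follows from \<open>exp z \<ge> 1 + z\<close>
  and \<open>(1 - z + z^2) (1 + z) = 1 + z^3\<close>.\<close>

lemma exp_le_quadratic:
  fixes y :: real assumes "\<bar>y\<bar> \<le> 1" shows "exp y \<le> 1 + y + y\<^sup>2"
proof (cases "0 \<le> y")
  case True then show ?thesis using exp_bound[of y] assms by simp
next
  case False
  define z where "z = - y"
  have z: "0 < z" using False by (simp add: z_def)
  have "exp y = 1 / exp z" by (simp add: z_def exp_minus field_simps)
  also have "\<dots> \<le> 1 / (1 + z)" using z exp_ge_add_one_self[of z] by (intro divide_left_mono) auto
  also have "\<dots> \<le> 1 - z + z\<^sup>2"
  proof -
    have "1 \<le> (1 - z + z\<^sup>2) * (1 + z)" using z by (simp add: algebra_simps power2_eq_square)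
    then show ?thesis using z by (simp add: pos_divide_le_eq)
  qed
  finally show ?thesis by (simp add: z_def)
qed

text \<open>The relative entropy of the tilted measure is \<open>t\<^sup>2\<close> times the derivative of \<open>ln Z(t) / t\<close>,
  whose increase over \<open>[r/2, \<kappa>]\<close> is more than \<open>r/2\<close>.\<close>
lemma tilt_with_large_entropy:
  fixes \<mu> f :: "'b \<Rightarrow> real"
  assumes fin: "finite X" and \<mu>: "\<And>x. x \<in> X \<Longrightarrow> 0 \<le> \<mu> x" "sum \<mu> X = 1"
    and osc: "\<And>x y. f x - f y \<le> 1" and r: "0 < r" "r < 1" and \<kappa>: "0 < \<kappa>"
    and big: "\<kappa> * (\<Sum>x\<in>X. f x * \<mu> x) + \<kappa> * r < ln (\<Sum>x\<in>X. \<mu> x * exp (\<kappa> * f x))"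
  obtains t where "r / 2 \<le> t" "t \<le> \<kappa>"
    "r / (2 * \<kappa>) * t\<^sup>2 \<le> t * ((\<Sum>x\<in>X. \<mu> x * exp (t * f x) * f x) / (\<Sum>x\<in>X. \<mu> x * exp (t * f x)))
        - ln (\<Sum>x\<in>X. \<mu> x * exp (t * f x))"
proof -
  define Z where "Z t = (\<Sum>x\<in>X. \<mu> x * exp (t * f x))" for t
  define Z' where "Z' t = (\<Sum>x\<in>X. \<mu> x * exp (t * f x) * f x)" for t
  define F where "F = (\<Sum>x\<in>X. f x * \<mu> x)"
  have "\<exists>x\<in>X. 0 < \<mu> x"
  proof (rule ccontr)
    assume "\<not> ?thesis"
    then have "sum \<mu> X \<le> 0" by (intro sum_nonpos) auto
    then show False using \<mu> by simp
  qed
  then have Zpos: "0 < Z t" for t unfolding Z_def using \<mu> fin by (force intro: sum_pos2)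
  have dev: "\<bar>f x - F\<bar> \<le> 1" for x
  proof -
    have "f x - F = (\<Sum>y\<in>X. \<mu> y * (f x - f y))" using \<mu>
      by (simp add: F_def left_diff_distrib sum_subtractf mult.commute[of "\<mu> _"] flip: sum_distrib_left)
    moreover have "\<dots> \<le> (\<Sum>y\<in>X. \<mu> y * 1)" using \<mu> osc by (intro sum_mono mult_left_mono) auto
    moreover have "(\<Sum>y\<in>X. \<mu> y * (-1)) \<le> (\<Sum>y\<in>X. \<mu> y * (f x - f y))"
    proof (intro sum_mono mult_left_mono)
      show "-1 \<le> f x - f y" for y using osc[of y x] by simp
    qed (use \<mu> in auto)
    ultimately show ?thesis using \<mu> by (simp add: sum_negf)
  qed
  \<comment> \<open>Second-order expansion about the mean \<open>F\<close>: the linear term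
    integrates to zero, and \<open>dev\<close> bounds the square.\<close>
  have small: "ln (Z t) \<le> t * F + t\<^sup>2" if t: "0 \<le> t" "t \<le> 1" for t
  proof -
    have "Z t = exp (t * F) * (\<Sum>x\<in>X. \<mu> x * exp (t * (f x - F)))"
      by (simp add: Z_def sum_distrib_left right_diff_distrib exp_diff)
    also have "(\<Sum>x\<in>X. \<mu> x * exp (t * (f x - F))) \<le> (\<Sum>x\<in>X. \<mu> x * (1 + t * (f x - F) + t\<^sup>2))"
    proof (intro sum_mono mult_left_mono)
      fix x
      have "\<bar>t * (f x - F)\<bar> \<le> 1" using t dev[of x] by (simp add: abs_mult mult_le_one)
      then have "exp (t * (f x - F)) \<le> 1 + t * (f x - F) + (t * (f x - F))\<^sup>2" by (rule exp_le_quadratic)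
      also have "(t * (f x - F))\<^sup>2 \<le> t\<^sup>2"
        using dev[of x] by (simp add: power_mult_distrib mult_left_le abs_square_le_1)
      finally show "exp (t * (f x - F)) \<le> 1 + t * (f x - F) + t\<^sup>2" by simp
    qed (use \<mu> in auto)
    also have "\<dots> = (\<Sum>x\<in>X. \<mu> x) + t * ((\<Sum>x\<in>X. f x * \<mu> x) - (\<Sum>x\<in>X. \<mu> x) * F) + (\<Sum>x\<in>X. \<mu> x) * t\<^sup>2"
      by (simp add: algebra_simps sum.distrib sum_subtractf sum_distrib_left sum_distrib_right)
    also have "\<dots> = 1 + t\<^sup>2" using \<mu> by (simp add: F_def)
    finally have "Z t \<le> exp (t * F) * (1 + t\<^sup>2)" by simp
    then have "ln (Z t) \<le> ln (exp (t * F) * (1 + t\<^sup>2))" using Zpos by (subst ln_le_cancel_iff) (auto intro!: mult_pos_pos add_pos_nonneg)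
    also have "\<dots> = t * F + ln (1 + t\<^sup>2)" by (subst ln_mult_pos) (auto simp: add_pos_nonneg)
    also have "\<dots> \<le> t * F + t\<^sup>2" by (simp add: ln_add_one_self_le_self)
    finally show ?thesis .
  qed
  have big': "\<kappa> * F + \<kappa> * r < ln (Z \<kappa>)" using big by (simp add: F_def Z_def)
  \<comment> \<open>Otherwise the quadratic bound at \<open>\<kappa>\<close> itself would contradict
    \<open>big'\<close>.\<close>
  have "r / 2 < \<kappa>"
  proof (rule ccontr)
    assume "\<not> r / 2 < \<kappa>"
    then have "\<kappa> \<le> r / 2" by simp
    then have "ln (Z \<kappa>) \<le> \<kappa> * F + \<kappa>\<^sup>2" using r \<kappa> by (intro small) auto
    also have "\<kappa>\<^sup>2 \<le> \<kappa> * r" using \<open>\<kappa> \<le> r / 2\<close> \<kappa> r by (simp add: power2_eq_square)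
    finally show False using big' by simp
  qed
  have DZ: "(Z has_real_derivative Z' t) (at t)" for t
    unfolding Z_def Z'_def by (rule derivative_eq_intros refl)+ (simp add: mult_ac)
  have D: "((\<lambda>t. ln (Z t) / t) has_real_derivative (t * (Z' t / Z t) - ln (Z t)) / t\<^sup>2) (at t)"
    if "0 < t" for t
    by (rule derivative_eq_intros DZ refl | use Zpos that in force)+
      (use that in \<open>simp add: field_simps power2_eq_square\<close>)
  \<comment> \<open>The quotient is singular at 0, so the interval starts at \<open>r / 2\<close>;
    there the quotient is at most \<open>F + r / 2\<close>, whereas at \<open>\<kappa>\<close> it
    exceeds \<open>F + r\<close>.\<close>
  have "\<exists>t>r / 2. t < \<kappa> \<and> ln (Z \<kappa>) / \<kappa> - ln (Z (r / 2)) / (r / 2) = (\<kappa> - r / 2) * ((t * (Z' t / Z t) - ln (Z t)) / t\<^sup>2)"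
    by (rule MVT2) (use D r \<open>r / 2 < \<kappa>\<close> in auto)
  then obtain t where t: "r / 2 < t" "t < \<kappa>"
    and eq: "ln (Z \<kappa>) / \<kappa> - ln (Z (r / 2)) / (r / 2) = (\<kappa> - r / 2) * ((t * (Z' t / Z t) - ln (Z t)) / t\<^sup>2)"
    by blast
  define G where "G = (t * (Z' t / Z t) - ln (Z t)) / t\<^sup>2"
  have "F + r < ln (Z \<kappa>) / \<kappa>" using big' \<kappa> by (simp add: field_simps)
  moreover have "ln (Z (r / 2)) / (r / 2) \<le> F + r / 2"
    using small[of "r / 2"] r by (simp add: field_simps power2_eq_square)
  ultimately have *: "r / 2 < (\<kappa> - r / 2) * G" using eq unfolding G_def[symmetric] by linarith
  then have "0 < G" using \<open>r / 2 < \<kappa>\<close> r by (smt (verit) mult_nonneg_nonpos divide_pos_pos)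
  then have "(\<kappa> - r / 2) * G \<le> \<kappa> * G" using r by (intro mult_right_mono) auto
  then have "r / (2 * \<kappa>) \<le> G" using * \<kappa> by (simp add: field_simps)
  then have "r / (2 * \<kappa>) * t\<^sup>2 \<le> t * (Z' t / Z t) - ln (Z t)"
    using t r by (simp add: G_def field_simps)
  then show thesis using that[of t] t by (simp add: Z_def Z'_def)
qed

text \<open>Relative entropy is at most the chi-squared divergence
  \<open>(\<rho> - b)^2 / (b (1 - b))\<close>. The ratio bounds give a relative error of order
  \<open>s\<close>; one factor \<open>\<rho>\<close> is retained so that integration yields the mass
  of the split-off piece.\<close>

lemma binary_rel_ent_le:
  fixes \<rho> b s :: real
  assumes \<rho>: "0 < \<rho>" "\<rho> \<le> 1/2" and b: "0 < b" "b \<le> 1/2" and s: "0 \<le> s" "s \<le> 1/2"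
    and le: "\<rho> \<le> exp s * b" "b \<le> exp s * \<rho>"
  shows "\<rho> * ln (\<rho> / b) + (1 - \<rho>) * ln ((1 - \<rho>) / (1 - b)) \<le> 16 * s\<^sup>2 * \<rho>"
proof -
  have "s\<^sup>2 \<le> s" using s by (simp add: power2_eq_square mult_left_le)
  then have es: "exp s \<le> 1 + 2 * s" using exp_bound[of s] s by simp
  have h1: "b - \<rho> \<le> 2 * s * \<rho>" using le(2) mult_right_mono[OF es, of \<rho>] \<rho> by (simp add: algebra_simps)
  have h2: "\<rho> - b \<le> 2 * s * b" using le(1) mult_right_mono[OF es, of b] b by (simp add: algebra_simps)
  have h3: "\<rho> \<le> 2 * b" using h2 mult_right_mono[of "2 * s" 1 b] s b by linarith
  have "\<bar>\<rho> - b\<bar> \<le> 2 * s * \<rho>"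
  proof (cases "b \<le> \<rho>")
    case True
    then have "2 * s * b \<le> 2 * s * \<rho>" using s by (intro mult_left_mono) auto
    then show ?thesis using h2 True by simp
  qed (use h1 in simp)
  then have "\<bar>\<rho> - b\<bar>\<^sup>2 \<le> (2 * s * \<rho>)\<^sup>2" by (intro power_mono) auto
  then have sq: "(\<rho> - b)\<^sup>2 \<le> 4 * s\<^sup>2 * \<rho>\<^sup>2" by (simp add: power_mult_distrib)
  have "\<rho> * ln (\<rho> / b) \<le> \<rho> * (\<rho> / b - 1)" using \<rho> b by (intro mult_left_mono ln_le_minus_one) auto
  moreover have "(1 - \<rho>) * ln ((1 - \<rho>) / (1 - b)) \<le> (1 - \<rho>) * ((1 - \<rho>) / (1 - b) - 1)"
    using \<rho> b by (intro mult_left_mono ln_le_minus_one) auto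
  moreover have "\<rho> * (\<rho> / b - 1) + (1 - \<rho>) * ((1 - \<rho>) / (1 - b) - 1) = (\<rho> - b)\<^sup>2 / (b * (1 - b))"
    using b by (simp add: field_simps power2_eq_square)
  moreover have "(\<rho> - b)\<^sup>2 / (b * (1 - b)) \<le> 16 * s\<^sup>2 * \<rho>"
  proof -
    note sq
    also have "4 * s\<^sup>2 * \<rho>\<^sup>2 = 4 * s\<^sup>2 * \<rho> * \<rho>" by (simp add: power2_eq_square)
    also have "\<dots> \<le> 4 * s\<^sup>2 * \<rho> * (2 * b)" using h3 \<rho> by (intro mult_left_mono) auto
    also have "\<dots> = 16 * s\<^sup>2 * \<rho> * (b * (1 / 2))" by simp
    also have "\<dots> \<le> 16 * s\<^sup>2 * \<rho> * (b * (1 - b))"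
      using \<rho> b by (intro mult_left_mono) auto
    finally show ?thesis using b by (simp add: pos_divide_le_eq)
  qed
  ultimately show ?thesis by linarith
qed

text \<open>The left-hand side is the conditional mutual information of coordinate \<open>i\<close> with the
  label of the piece; it is quadratically small because \<open>\<rho>\<close> varies little along each fibre.\<close>
lemma neg_cond_ent_split_le:
  fixes m \<rho> :: "(nat \<Rightarrow> 'a::finite) \<Rightarrow> real"
  assumes m: "nonneg_on n m" and i: "i < n" and \<rho>: "\<And>x. 0 < \<rho> x" "\<And>x. \<rho> x \<le> 1/2"
    and s: "0 \<le> s" "s \<le> 1/2" and lip: "\<And>x a. \<rho> (x(i := a)) \<le> exp s * \<rho> x"
  shows "neg_cond_ent n i (\<lambda>x. \<rho> x * m x) + neg_cond_ent n i (\<lambda>x. (1 - \<rho> x) * m x) - neg_cond_ent n i m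
    \<le> 16 * s\<^sup>2 * mass n (\<lambda>x. \<rho> x * m x)"
proof -
  let ?m1 = "\<lambda>x. \<rho> x * m x" and ?m2 = "\<lambda>x. (1 - \<rho> x) * m x"
  have pt: "?m1 x * ln (?m1 x / fibre_mass i ?m1 x) + ?m2 x * ln (?m2 x / fibre_mass i ?m2 x)
      - m x * ln (m x / fibre_mass i m x) \<le> 16 * s\<^sup>2 * ?m1 x" if x: "x \<in> cube n" for x
  proof (cases "m x = 0")
    case False
    then have mx: "0 < m x" using m x by (auto simp: nonneg_on_def order_less_le)
    define M where "M = fibre_mass i m x"
    \<comment> \<open>The mean of \<open>\<rho>\<close> on the fibre of \<open>x\<close>, which is
      the conditional probability of the first piece given the other coordinates.\<close>
    define b where "b = fibre_mass i ?m1 x / M"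
    have M: "0 < M" using fibre_mass_ge[OF m x i] mx by (simp add: M_def)
    have mn: "0 \<le> m (x(i := a))" for a using m fun_upd_in_cube[OF x i] by (simp add: nonneg_on_def)
    have m1: "fibre_mass i ?m1 x = b * M" using M by (simp add: b_def)
    have "fibre_mass i ?m2 x = M - fibre_mass i ?m1 x"
      by (simp add: M_def fibre_mass_def left_diff_distrib sum_subtractf)
    then have m2: "fibre_mass i ?m2 x = (1 - b) * M" by (simp add: m1 left_diff_distrib)
    have "fibre_mass i ?m1 x \<le> (\<Sum>a\<in>UNIV. exp s * \<rho> x * m (x(i := a)))"
      unfolding fibre_mass_def by (intro sum_mono mult_right_mono lip mn)
    also have "\<dots> = exp s * \<rho> x * M" by (simp add: M_def fibre_mass_def sum_distrib_left)
    finally have b1: "b \<le> exp s * \<rho> x" using M by (simp add: m1)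
    have "(\<Sum>a\<in>UNIV. \<rho> x * m (x(i := a))) \<le> (\<Sum>a\<in>UNIV. exp s * \<rho> (x(i := a)) * m (x(i := a)))"
    proof (intro sum_mono mult_right_mono mn)
      show "\<rho> x \<le> exp s * \<rho> (x(i := a))" for a using lip[of "x(i := a)" "x i"] by simp
    qed
    also have "\<dots> = exp s * fibre_mass i ?m1 x" by (simp add: fibre_mass_def sum_distrib_left mult.assoc)
    also have "(\<Sum>a\<in>UNIV. \<rho> x * m (x(i := a))) = \<rho> x * M" by (simp add: M_def fibre_mass_def sum_distrib_left)
    finally have b2: "\<rho> x \<le> exp s * b" using M by (simp add: m1 flip: mult.assoc)
    then have b0: "0 < b" using \<rho>(1)[of x] by (smt (verit) exp_gt_zero mult_nonneg_nonpos)
    have "fibre_mass i ?m1 x \<le> (\<Sum>a\<in>UNIV. 1/2 * m (x(i := a)))"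
      unfolding fibre_mass_def by (intro sum_mono mult_right_mono \<rho> mn)
    also have "\<dots> = 1/2 * M" by (simp add: M_def fibre_mass_def sum_divide_distrib)
    finally have bh: "b \<le> 1/2" using M unfolding m1 by simp
    \<comment> \<open>The weights \<open>\<rho> x\<close> and \<open>1 - \<rho> x\<close> add up to
      1, so the terms in \<open>ln (m x / M)\<close> cancel and a binary relative entropy
      remains.\<close>
    have "?m1 x * ln (?m1 x / fibre_mass i ?m1 x) + ?m2 x * ln (?m2 x / fibre_mass i ?m2 x) - m x * ln (m x / M)
       = m x * (\<rho> x * ln (\<rho> x / b) + (1 - \<rho> x) * ln ((1 - \<rho> x) / (1 - b)))"
    proof -
      have pos: "0 < \<rho> x" "0 < 1 - \<rho> x" "0 < 1 - b" using \<rho>(1)[of x] \<rho>(2)[of x] bh by auto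
      have "ln (?m1 x / (b * M)) = ln (\<rho> x / b) + ln (m x / M)"
        using ln_mult_pos[of "\<rho> x / b" "m x / M"] pos b0 mx M by simp
      moreover have "ln (?m2 x / ((1 - b) * M)) = ln ((1 - \<rho> x) / (1 - b)) + ln (m x / M)"
        using ln_mult_pos[of "(1 - \<rho> x) / (1 - b)" "m x / M"] pos mx M by simp
      ultimately show ?thesis unfolding m1 m2 by (simp add: algebra_simps)
    qed
    also have "\<dots> \<le> m x * (16 * s\<^sup>2 * \<rho> x)"
      using mx by (intro mult_left_mono binary_rel_ent_le \<rho> b0 bh s b1 b2) auto
    finally show ?thesis by (simp add: M_def mult_ac)
  qed simp
  have "neg_cond_ent n i ?m1 + neg_cond_ent n i ?m2 - neg_cond_ent n i m
    = (\<Sum>x\<in>cube n. ?m1 x * ln (?m1 x / fibre_mass i ?m1 x) + ?m2 x * ln (?m2 x / fibre_mass i ?m2 x)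
      - m x * ln (m x / fibre_mass i m x))"
    by (simp add: neg_cond_ent_def sum.distrib sum_subtractf)
  also have "\<dots> \<le> (\<Sum>x\<in>cube n. 16 * s\<^sup>2 * ?m1 x)" by (rule sum_mono) (use pt in auto)
  also have "\<dots> = 16 * s\<^sup>2 * mass n ?m1" by (simp add: mass_def sum_distrib_left)
  finally show ?thesis .
qed

section \<open>From a failed transport inequality to a large log-Laplace transform\<close>

lemma KL_nonneg:
  fixes \<nu> \<mu> :: "(nat \<Rightarrow> 'a::finite) \<Rightarrow> real"
  assumes "is_prob n \<nu>" "is_prob n \<mu>" "abs_cont n \<nu> \<mu>"
  shows "0 \<le> KL n \<nu> \<mu>"
proof -
  have "0 \<le> (\<Sum>x\<in>cube n. \<nu> x * ln (\<nu> x / \<mu> x))"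
    by (rule gibbs_inequality) (use assms in \<open>auto simp: is_prob_def abs_cont_def order_less_le\<close>)
  also have "\<dots> = KL n \<nu> \<mu>" unfolding KL_def by (rule sum.cong) auto
  finally show ?thesis .
qed

text \<open>Gibbs' inequality for \<open>\<nu>\<close> against the tilted probability measure
  \<open>\<mu> exp g / Z\<close>.\<close>

lemma gibbs_variational:
  fixes \<nu> \<mu> :: "(nat \<Rightarrow> 'a::finite) \<Rightarrow> real"
  assumes \<nu>: "is_prob n \<nu>" and \<mu>: "is_prob n \<mu>" and ac: "abs_cont n \<nu> \<mu>"
  shows "(\<Sum>x\<in>cube n. g x * \<nu> x) - KL n \<nu> \<mu> \<le> ln (\<Sum>x\<in>cube n. \<mu> x * exp (g x))"
proof -
  define Z where "Z = (\<Sum>x\<in>cube n. \<mu> x * exp (g x))"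
  have "\<exists>x\<in>cube n. 0 < \<nu> x"
  proof (rule ccontr)
    assume "\<not> ?thesis"
    then have "sum \<nu> (cube n) \<le> 0" by (intro sum_nonpos) auto
    then show False using \<nu> by (simp add: is_prob_def)
  qed
  then obtain x0 where x0: "x0 \<in> cube n" "0 < \<nu> x0" by auto
  have pos: "0 < \<mu> x" if "x \<in> cube n" "0 < \<nu> x" for x
    using that \<mu> ac by (force simp: is_prob_def abs_cont_def order_less_le)
  have Z: "0 < Z" unfolding Z_def
    by (rule sum_pos2[OF _ x0(1)]) (use pos[OF x0] \<mu> in \<open>auto simp: is_prob_def\<close>)
  have "0 \<le> (\<Sum>x\<in>cube n. \<nu> x * ln (\<nu> x / (\<mu> x * exp (g x) / Z)))"
  proof (rule gibbs_inequality)
    have "(\<Sum>x\<in>cube n. \<mu> x * exp (g x) / Z) = 1" using Z by (simp add: Z_def flip: sum_divide_distrib)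
    then show "(\<Sum>x\<in>cube n. \<mu> x * exp (g x) / Z) \<le> sum \<nu> (cube n)" using \<nu> by (simp add: is_prob_def)
  qed (use \<nu> \<mu> Z pos in \<open>auto simp: is_prob_def\<close>)
  also have "\<dots> = (\<Sum>x\<in>cube n. (if \<nu> x = 0 then 0 else \<nu> x * ln (\<nu> x / \<mu> x)) - g x * \<nu> x + \<nu> x * ln Z)"
  proof (rule sum.cong)
    fix x :: "nat \<Rightarrow> 'a" assume x: "x \<in> cube n"
    show "\<nu> x * ln (\<nu> x / (\<mu> x * exp (g x) / Z)) = (if \<nu> x = 0 then 0 else \<nu> x * ln (\<nu> x / \<mu> x)) - g x * \<nu> x + \<nu> x * ln Z"
    proof (cases "\<nu> x = 0")
      case False
      then have "0 < \<nu> x" using \<nu> x by (auto simp: is_prob_def order_less_le)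
      then show ?thesis using pos[OF x] Z by (simp add: ln_div ln_mult algebra_simps)
    qed simp
  qed simp
  also have "\<dots> = KL n \<nu> \<mu> - (\<Sum>x\<in>cube n. g x * \<nu> x) + ln Z"
    using \<nu> by (simp add: sum.distrib sum_subtractf KL_def is_prob_def flip: sum_distrib_right)
  finally show ?thesis by (simp add: Z_def)
qed

text \<open>The variational principle for \<open>\<kappa> f\<close>, with \<open>f\<close> the
  Kantorovich witness, cancels the relative entropy and eliminates the violating measure. A distance
  above \<open>r\<close> is impossible if \<open>r \<ge> 1\<close> or \<open>n = 0\<close>, which
  gives the two side conditions.\<close>

lemma not_transport_ineq_witness:
  fixes \<mu> :: "(nat \<Rightarrow> 'a::finite) \<Rightarrow> real"
  assumes \<mu>: "is_prob n \<mu>" and r: "0 < r" and bad: "\<not> transport_ineq n \<mu> (r * real n / 200) r"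
  obtains f where "0 < n" "r < 1" "\<And>x y. f x - f y \<le> hamming n x y"
    "(r * real n / 200) * (\<Sum>x\<in>cube n. f x * \<mu> x) + (r * real n / 200) * r
      < ln (\<Sum>x\<in>cube n. \<mu> x * exp ((r * real n / 200) * f x))"
proof -
  define \<kappa> where "\<kappa> = r * real n / 200"
  obtain \<nu> where \<nu>: "is_prob n \<nu>" "abs_cont n \<nu> \<mu>" and lt: "KL n \<nu> \<mu> / \<kappa> + r < dbar n \<nu> \<mu>"
    using bad by (auto simp: transport_ineq_def \<kappa>_def not_le)
  have KL: "0 \<le> KL n \<nu> \<mu> / \<kappa>" using KL_nonneg[OF \<nu>(1) \<mu> \<nu>(2)] r by (simp add: \<kappa>_def)
  have "dbar n \<nu> \<mu> \<le> 1" by (rule dbar_le_bound[OF \<nu>(1) \<mu> hamming_le_1])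
  then have r1: "r < 1" using lt KL by simp
  have n: "0 < n"
  proof (rule ccontr)
    assume "\<not> 0 < n"
    then have "dbar n \<nu> \<mu> \<le> 0" by (intro dbar_le_bound[OF \<nu>(1) \<mu>]) (simp add: hamming_def)
    then show False using lt KL r by simp
  qed
  have \<kappa>: "0 < \<kappa>" using r n by (simp add: \<kappa>_def)
  obtain f where lip: "\<And>x y. f x - f y \<le> hamming n x y"
    and f: "KL n \<nu> \<mu> / \<kappa> + r < (\<Sum>x\<in>cube n. f x * \<nu> x) - (\<Sum>x\<in>cube n. f x * \<mu> x)"
    using kantorovich_lipschitz_witness[OF \<nu>(1) \<mu> lt] by blast
  have "KL n \<nu> \<mu> + \<kappa> * r < \<kappa> * (\<Sum>x\<in>cube n. f x * \<nu> x) - \<kappa> * (\<Sum>x\<in>cube n. f x * \<mu> x)"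
    using mult_strict_left_mono[OF f \<kappa>] \<kappa> by (simp add: algebra_simps)
  moreover have "\<kappa> * (\<Sum>x\<in>cube n. f x * \<nu> x) - KL n \<nu> \<mu> \<le> ln (\<Sum>x\<in>cube n. \<mu> x * exp (\<kappa> * f x))"
    using gibbs_variational[OF \<nu>(1) \<mu> \<nu>(2), of "\<lambda>x. \<kappa> * f x"] by (simp add: sum_distrib_left mult.assoc)
  ultimately have "\<kappa> * (\<Sum>x\<in>cube n. f x * \<mu> x) + \<kappa> * r < ln (\<Sum>x\<in>cube n. \<mu> x * exp (\<kappa> * f x))" by simp
  then show thesis using that[OF n r1 lip] by (simp add: \<kappa>_def)
qed

text \<open>Null pieces have no normalisation and are excluded; at the end they join the bad pieces
  in the first part of the partition.\<close>

definition bad_piece :: "nat \<Rightarrow> real \<Rightarrow> ((nat \<Rightarrow> 'a) \<Rightarrow> real) \<Rightarrow> bool" where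
  "bad_piece n r m \<longleftrightarrow> 0 < mass n m \<and> \<not> transport_ineq n (\<lambda>x. m x / mass n m) (r * real n / 200) r"

text \<open>With \<open>P = t^2 / n * mass n m1\<close>, the split reveals information at least
  \<open>100 * P\<close>, while the coordinatewise terms cost at most \<open>16 * P\<close>. The
  guaranteed decrease per unit of mass is the same for all bad pieces, which makes the iteration
  stop.\<close>

lemma split_bad_piece:
  fixes m :: "(nat \<Rightarrow> 'a::finite) \<Rightarrow> real"
  assumes m: "nonneg_on n m" and r: "0 < r" and bad: "bad_piece n r m"
  obtains m1 m2 where "0 < n" "nonneg_on n m1" "nonneg_on n m2" "\<And>x. m x = m1 x + m2 x"
    "neg_ent n m1 + neg_ent n m2 - neg_ent n m \<le> 2 * (dtc_mass n m - (dtc_mass n m1 + dtc_mass n m2))"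
    "6 * r\<^sup>2 * exp (- (r * real n / 200)) / real n * mass n m \<le> dtc_mass n m - (dtc_mass n m1 + dtc_mass n m2)"
proof -
  define \<kappa> where "\<kappa> = r * real n / 200"
  define W where "W = mass n m"
  have W: "0 < W" and bad': "\<not> transport_ineq n (\<lambda>x. m x / W) (r * real n / 200) r"
    using bad by (auto simp: bad_piece_def W_def)
  define \<mu> where "\<mu> x = m x / W" for x
  have \<mu>: "is_prob n \<mu>" using m W
    by (simp add: is_prob_def \<mu>_def nonneg_on_def W_def mass_def flip: sum_divide_distrib)
  obtain f where n: "0 < n" and r1: "r < 1" and lip: "\<And>x y. f x - f y \<le> hamming n x y"
    and big: "\<kappa> * (\<Sum>x\<in>cube n. f x * \<mu> x) + \<kappa> * r < ln (\<Sum>x\<in>cube n. \<mu> x * exp (\<kappa> * f x))"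
    using not_transport_ineq_witness[OF \<mu> r] bad' unfolding \<mu>_def \<kappa>_def by blast
  have \<kappa>: "0 < \<kappa>" using r n by (simp add: \<kappa>_def)
  have osc: "f x - f y \<le> 1" for x y using lip[of x y] hamming_le_1[of n x y] by simp
  obtain t where t: "r / 2 \<le> t" "t \<le> \<kappa>"
    and D: "r / (2 * \<kappa>) * t\<^sup>2 \<le> t * ((\<Sum>x\<in>cube n. \<mu> x * exp (t * f x) * f x) / (\<Sum>x\<in>cube n. \<mu> x * exp (t * f x)))
        - ln (\<Sum>x\<in>cube n. \<mu> x * exp (t * f x))"
    by (rule tilt_with_large_entropy[of "cube n" \<mu> f r \<kappa>, OF _ _ _ osc r r1 \<kappa> big])
      (use \<mu> in \<open>auto simp: is_prob_def\<close>)
  have t0: "0 < t" using t r by simp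
  \<comment> \<open>The factor 200 in \<open>\<kappa>\<close> enters here.\<close>
  have rk: "r / (2 * \<kappa>) = 100 / n" using r n by (simp add: \<kappa>_def field_simps)
  define h where "h = (SUP x. f x)"
  have bdd: "bdd_above (range f)" by (rule bdd_aboveI[of _ "f undefined + 1"]) (use osc[of _ undefined] in \<open>auto simp: algebra_simps\<close>)
  have h1: "f x \<le> h" for x unfolding h_def by (rule cSUP_upper[OF _ bdd]) simp
  have h2: "h \<le> f x + 1" for x unfolding h_def
    by (rule cSUP_least) (use osc[of _ x] in \<open>auto simp: algebra_simps\<close>)
  \<comment> \<open>A multiple of the tilt density, scaled to stay between
    \<open>exp (- \<kappa>) / 2\<close> and 1/2; the lower end bounds the mass of the split-off
    piece.\<close>
  define \<rho> where "\<rho> x = exp (t * (f x - h)) / 2" for x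
  have \<rho>0: "0 < \<rho> x" and \<rho>h: "\<rho> x \<le> 1/2" for x
    using h1[of x] t0 by (auto simp: \<rho>_def mult_nonneg_nonpos)
  have \<rho>low: "exp (- \<kappa>) / 2 \<le> \<rho> x" for x
  proof -
    have "t * (h - f x) \<le> t * 1" using h2[of x] t0 by (intro mult_left_mono) auto
    then have "- \<kappa> \<le> t * (f x - h)" using t by (simp add: algebra_simps)
    then show ?thesis by (simp add: \<rho>_def)
  qed
  define m1 where "m1 x = \<rho> x * m x" for x
  define m2 where "m2 x = (1 - \<rho> x) * m x" for x
  have sum: "m x = m1 x + m2 x" for x by (simp add: m1_def m2_def algebra_simps)
  have nn1: "nonneg_on n m1" using m \<rho>0 by (auto simp: nonneg_on_def m1_def less_imp_le)
  have nn2: "nonneg_on n m2"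
    unfolding nonneg_on_def m2_def
  proof (intro ballI mult_nonneg_nonneg)
    show "0 \<le> 1 - \<rho> x" for x using \<rho>h[of x] by simp
  qed (use m in \<open>auto simp: nonneg_on_def\<close>)
  \<comment> \<open>Bounds the change of \<open>ln (\<rho> x)\<close> along one coordinate. The
    bounds \<open>t \<le> \<kappa>\<close> and \<open>r < 1\<close> keep it below 1/2.\<close>
  define s where "s = t / n"
  have s: "0 \<le> s" "s \<le> 1/2"
  proof -
    have "200 * t \<le> r * real n" using t(2) by (simp add: \<kappa>_def)
    also have "\<dots> \<le> 1 * real n" using r1 by (intro mult_right_mono) auto
    finally have "2 * t \<le> real n" using t0 by simp
    then show "0 \<le> s" "s \<le> 1/2" using t0 n by (auto simp: s_def field_simps)
  qed
  have var: "\<rho> (x(i := a)) \<le> exp s * \<rho> x" for x i a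
  proof -
    have "hamming n (x(i := a)) x \<le> 1 / n" using hamming_upd[of n "x(i := a)" i "x i"] by simp
    then have "f (x(i := a)) - f x \<le> 1 / n" using lip[of "x(i := a)" x] by simp
    then have "t * (f (x(i := a)) - f x) \<le> t * (1 / n)" using t0 by (intro mult_left_mono) auto
    then have "t * (f (x(i := a)) - h) \<le> s + t * (f x - h)" by (simp add: s_def algebra_simps)
    then show ?thesis by (simp add: \<rho>_def flip: exp_add)
  qed
  have dE: "(\<Sum>i<n. neg_cond_ent n i m1) + (\<Sum>i<n. neg_cond_ent n i m2) - (\<Sum>i<n. neg_cond_ent n i m)
      \<le> 16 * t\<^sup>2 / n * mass n m1"
  proof -
    have "(\<Sum>i<n. neg_cond_ent n i m1 + neg_cond_ent n i m2 - neg_cond_ent n i m) \<le> (\<Sum>i<n. 16 * s\<^sup>2 * mass n m1)"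
      unfolding m1_def m2_def
      by (intro sum_mono neg_cond_ent_split_le m \<rho>0 \<rho>h s var) auto
    also have "\<dots> = 16 * t\<^sup>2 / n * mass n m1" using n by (simp add: s_def power2_eq_square)
    finally show ?thesis by (simp add: sum.distrib sum_subtractf)
  qed
  define Z where "Z = (\<Sum>x\<in>cube n. \<mu> x * exp (t * f x))"
  define Y where "Y = (\<Sum>x\<in>cube n. \<mu> x * exp (t * f x) * f x)"
  \<comment> \<open>A constant factor that cancels on normalisation, so the normalised
    \<open>m1\<close> is exactly the tilted measure.\<close>
  define c where "c = exp (- (t * h)) / 2"
  have c: "0 < c" by (simp add: c_def)
  have m1c: "m1 x = c * W * (\<mu> x * exp (t * f x))" for x
    using W by (simp add: m1_def \<rho>_def c_def \<mu>_def right_diff_distrib exp_diff exp_minus field_simps)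
  have M1: "mass n m1 = c * W * Z" by (simp add: mass_def m1c Z_def sum_distrib_left)
  have M1low: "exp (- \<kappa>) / 2 * W \<le> mass n m1"
    unfolding mass_def W_def sum_distrib_left m1_def
    by (intro sum_mono mult_right_mono \<rho>low) (use m in \<open>auto simp: nonneg_on_def\<close>)
  then have M1pos: "0 < mass n m1" using W by (smt (verit) exp_gt_zero half_gt_zero mult_pos_pos)
  then have Z: "0 < Z" using c W unfolding M1 by (simp add: zero_less_mult_pos[of "c * W" Z])
  have "(\<Sum>x\<in>cube n. m1 x * (ln (m1 x / mass n m1) - ln (m x / mass n m))) = (\<Sum>x\<in>cube n. m1 x * (t * f x - ln Z))"
  proof (rule sum.cong)
    fix x :: "nat \<Rightarrow> 'a" assume x: "x \<in> cube n"
    show "m1 x * (ln (m1 x / mass n m1) - ln (m x / mass n m)) = m1 x * (t * f x - ln Z)"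
    proof (cases "m x = 0")
      case False
      then have "0 < m x" using m x by (auto simp: nonneg_on_def order_less_le)
      then have mu: "0 < \<mu> x" using W by (simp add: \<mu>_def)
      have "m1 x / mass n m1 = \<mu> x * exp (t * f x) / Z" using c W by (simp add: m1c M1)
      moreover have "m x / mass n m = \<mu> x" by (simp add: \<mu>_def W_def)
      ultimately show ?thesis using mu Z by (simp add: ln_div ln_mult)
    qed (simp add: m1_def)
  qed simp
  also have "\<dots> = c * W * (t * Y - Z * ln Z)"
    by (simp add: m1c Y_def Z_def sum_distrib_left sum_distrib_right sum_subtractf algebra_simps)
  also have "\<dots> = mass n m1 * (t * (Y / Z) - ln Z)" using Z by (simp add: M1 field_simps)
  finally have ent1: "(\<Sum>x\<in>cube n. m1 x * (ln (m1 x / mass n m1) - ln (m x / mass n m))) = mass n m1 * (t * (Y / Z) - ln Z)" .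
  have ent2: "0 \<le> (\<Sum>x\<in>cube n. m2 x * (ln (m2 x / mass n m2) - ln (m x / mass n m)))"
    by (rule rel_ent_nonneg[OF nn2]) (use nn1 sum in \<open>auto simp: nonneg_on_def\<close>)
  define P where "P = t\<^sup>2 / n * mass n m1"
  have "mass n m1 * (t * (Y / Z) - ln Z) \<le> neg_ent n m1 + neg_ent n m2 - neg_ent n m"
    using neg_ent_add[of n m m1 m2] sum ent1 ent2 by simp
  moreover have "mass n m1 * (100 / n * t\<^sup>2) \<le> mass n m1 * (t * (Y / Z) - ln Z)"
    using D M1pos unfolding rk Y_def Z_def by (intro mult_left_mono) auto
  ultimately have dL: "100 * P \<le> neg_ent n m1 + neg_ent n m2 - neg_ent n m"
    by (simp add: P_def algebra_simps)
  have dE': "(\<Sum>i<n. neg_cond_ent n i m1) + (\<Sum>i<n. neg_cond_ent n i m2) - (\<Sum>i<n. neg_cond_ent n i m)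
      \<le> 16 * P" using dE by (simp add: P_def)
  have p: "0 \<le> P" using M1pos by (simp add: P_def)
  have dQ: "neg_ent n m1 + neg_ent n m2 - neg_ent n m - 16 * P \<le> dtc_mass n m - (dtc_mass n m1 + dtc_mass n m2)"
    using dE' unfolding dtc_mass_def by linarith
  show thesis
  proof (rule that[OF n nn1 nn2 sum])
    \<comment> \<open>Losing \<open>16 * P\<close> is at most half of the information as soon as
      that is at least \<open>32 * P\<close>.\<close>
    show "neg_ent n m1 + neg_ent n m2 - neg_ent n m \<le> 2 * (dtc_mass n m - (dtc_mass n m1 + dtc_mass n m2))"
      using dL dQ p by argo
    \<comment> \<open>The factor 48 is a convenient value below \<open>100 - 16\<close>; the rest
      comes from \<open>t \<ge> r / 2\<close> and \<open>M1low\<close>.\<close>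
    have "6 * r\<^sup>2 * exp (- \<kappa>) / real n * W = 48 * ((r/2)\<^sup>2 / n * (exp (- \<kappa>) / 2 * W))" 
      by (simp add: power2_eq_square)
    also have "\<dots> \<le> 48 * P" unfolding P_def
      using t(1) r W by (intro mult_left_mono mult_mono divide_right_mono power_mono M1low) auto
    also have "\<dots> \<le> dtc_mass n m - (dtc_mass n m1 + dtc_mass n m2)"
      using dL dQ p by linarith
    finally show "6 * r\<^sup>2 * exp (- (r * real n / 200)) / real n * mass n m \<le> dtc_mass n m - (dtc_mass n m1 + dtc_mass n m2)"
      by (simp add: \<kappa>_def W_def)
  qed
qed

section \<open>Iteration\<close>

text \<open>Lists rather than sets, since pieces may coincide and count with multiplicity.\<close>

definition bad_mass :: "nat \<Rightarrow> real \<Rightarrow> ((nat \<Rightarrow> 'a) \<Rightarrow> real) list \<Rightarrow> real" where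
  "bad_mass n r ms = (\<Sum>m\<leftarrow>ms. if bad_piece n r m then mass n m else 0)"

text \<open>One round of the iteration: every bad piece is replaced by its two parts and the others
  are kept. Both estimates are additive over the list.\<close>

lemma refine_pieces:
  fixes ms :: "((nat \<Rightarrow> 'a::finite) \<Rightarrow> real) list"
  assumes r: "0 < r" and "\<forall>m\<in>set ms. nonneg_on n m"
  shows "\<exists>ms'. (\<forall>m\<in>set ms'. nonneg_on n m) \<and> (\<forall>x. (\<Sum>m\<leftarrow>ms'. m x) = (\<Sum>m\<leftarrow>ms. m x)) \<and>
    (\<Sum>m\<leftarrow>ms'. neg_ent n m) - (\<Sum>m\<leftarrow>ms. neg_ent n m)
      \<le> 2 * ((\<Sum>m\<leftarrow>ms. dtc_mass n m) - (\<Sum>m\<leftarrow>ms'. dtc_mass n m)) \<and>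
    6 * r\<^sup>2 * exp (- (r * real n / 200)) / real n * bad_mass n r ms
      \<le> (\<Sum>m\<leftarrow>ms. dtc_mass n m) - (\<Sum>m\<leftarrow>ms'. dtc_mass n m)"
  using assms(2)
proof (induction ms)
  case Nil
  show ?case by (rule exI[of _ "[]"]) (simp add: bad_mass_def)
next
  case (Cons m ms)
  define c where "c = 6 * r\<^sup>2 * exp (- (r * real n / 200)) / real n"
  from Cons obtain ms' where ms': "\<forall>m\<in>set ms'. nonneg_on n m" "\<forall>x. (\<Sum>m\<leftarrow>ms'. m x) = (\<Sum>m\<leftarrow>ms. m x)"
    "(\<Sum>m\<leftarrow>ms'. neg_ent n m) - (\<Sum>m\<leftarrow>ms. neg_ent n m)
      \<le> 2 * ((\<Sum>m\<leftarrow>ms. dtc_mass n m) - (\<Sum>m\<leftarrow>ms'. dtc_mass n m))"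
    "c * bad_mass n r ms \<le> (\<Sum>m\<leftarrow>ms. dtc_mass n m) - (\<Sum>m\<leftarrow>ms'. dtc_mass n m)"
    unfolding c_def by auto
  have m: "nonneg_on n m" using Cons.prems by simp
  show ?case
  proof (cases "bad_piece n r m")
    case True
    obtain m1 m2 where "nonneg_on n m1" "nonneg_on n m2" "\<And>x. m x = m1 x + m2 x"
      "neg_ent n m1 + neg_ent n m2 - neg_ent n m \<le> 2 * (dtc_mass n m - (dtc_mass n m1 + dtc_mass n m2))"
      "c * mass n m \<le> dtc_mass n m - (dtc_mass n m1 + dtc_mass n m2)"
      using split_bad_piece[OF m r True] unfolding c_def by metis
    with ms' True show ?thesis unfolding c_def[symmetric]
      by (intro exI[of _ "m1 # m2 # ms'"]) (simp add: bad_mass_def distrib_left)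
  next
    case False
    with ms' m show ?thesis unfolding c_def[symmetric]
      by (intro exI[of _ "m # ms'"]) (simp add: bad_mass_def)
  qed
qed

lemma sum_list_dtc_nonneg:
  fixes ms :: "((nat \<Rightarrow> 'a::finite) \<Rightarrow> real) list"
  shows "\<forall>m\<in>set ms. nonneg_on n m \<Longrightarrow> 0 \<le> (\<Sum>m\<leftarrow>ms. dtc_mass n m)"
  by (rule sum_list_nonneg) (auto intro: dtc_mass_nonneg)

text \<open>Splitting all bad pieces at once lowers the total dual total correlation by at least a
  fixed multiple of the bad mass, so the bad mass cannot stay above \<open>\<epsilon>\<close> forever.\<close>
lemma pieces_with_small_bad_mass:
  fixes \<mu> :: "(nat \<Rightarrow> 'a::finite) \<Rightarrow> real"
  assumes r: "0 < r" and \<epsilon>: "0 < \<epsilon>" and \<mu>: "nonneg_on n \<mu>"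
  obtains ms where "\<forall>m\<in>set ms. nonneg_on n m" "\<And>x. (\<Sum>m\<leftarrow>ms. m x) = \<mu> x"
    "(\<Sum>m\<leftarrow>ms. neg_ent n m) - neg_ent n \<mu> \<le> 2 * dtc_mass n \<mu>" "bad_mass n r ms < \<epsilon>"
proof -
  \<comment> \<open>Invariant: the information revealed so far is at most twice the decrease of the
    dual total correlation.\<close>
  define P where "P ms \<longleftrightarrow> (\<forall>m\<in>set ms. nonneg_on n m) \<and> (\<forall>x. (\<Sum>m\<leftarrow>ms. m x) = \<mu> x) \<and>
    (\<Sum>m\<leftarrow>ms. neg_ent n m) - neg_ent n \<mu> \<le> 2 * (dtc_mass n \<mu> - (\<Sum>m\<leftarrow>ms. dtc_mass n m))" for ms
  define c where "c = 6 * r\<^sup>2 * exp (- (r * real n / 200)) / real n"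
  have P0: "P [\<mu>]" using \<mu> by (simp add: P_def)
  have "\<exists>ms. P ms \<and> bad_mass n r ms < \<epsilon>"
  proof (rule ccontr)
    assume "\<not> ?thesis"
    then have big: "\<epsilon> \<le> bad_mass n r ms" if "P ms" for ms using that by (auto simp: not_less)
    \<comment> \<open>The one-piece list must already be bad, which forces \<open>n > 0\<close> and
      hence a positive decrement.\<close>
    have "bad_piece n r \<mu>" using big[OF P0] \<epsilon> by (auto simp: bad_mass_def split: if_splits)
    then have "0 < n" using split_bad_piece[OF \<mu> r] by metis
    then have c: "0 < c" using r by (simp add: c_def)
    have "\<exists>ms. P ms \<and> (\<Sum>m\<leftarrow>ms. dtc_mass n m) \<le> dtc_mass n \<mu> - real k * (c * \<epsilon>)" for k
    proof (induction k)
      case 0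
      show ?case by (rule exI[of _ "[\<mu>]"]) (simp add: P0)
    next
      case (Suc k)
      then obtain ms where ms: "P ms" "(\<Sum>m\<leftarrow>ms. dtc_mass n m) \<le> dtc_mass n \<mu> - real k * (c * \<epsilon>)" by blast
      from ms(1) have "\<forall>m\<in>set ms. nonneg_on n m" by (simp add: P_def)
      from refine_pieces[OF r this] obtain ms' where ms': "\<forall>m\<in>set ms'. nonneg_on n m"
        "\<forall>x. (\<Sum>m\<leftarrow>ms'. m x) = (\<Sum>m\<leftarrow>ms. m x)"
        "(\<Sum>m\<leftarrow>ms'. neg_ent n m) - (\<Sum>m\<leftarrow>ms. neg_ent n m)
          \<le> 2 * ((\<Sum>m\<leftarrow>ms. dtc_mass n m) - (\<Sum>m\<leftarrow>ms'. dtc_mass n m))"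
        "c * bad_mass n r ms \<le> (\<Sum>m\<leftarrow>ms. dtc_mass n m) - (\<Sum>m\<leftarrow>ms'. dtc_mass n m)"
        unfolding c_def by blast
      have "P ms'" using ms(1) ms'(1-3) by (auto simp: P_def)
      moreover have "c * \<epsilon> \<le> c * bad_mass n r ms" using big[OF ms(1)] c by (simp add: mult_left_mono)
      ultimately show ?case using ms(2) ms'(4) by (intro exI[of _ ms']) (simp add: algebra_simps)
    qed
    \<comment> \<open>Nonnegativity of the remaining correlation bounds the number of
      rounds.\<close>
    then have "real k * (c * \<epsilon>) \<le> dtc_mass n \<mu>" for k
      using sum_list_dtc_nonneg unfolding P_def by (smt (verit))
    moreover obtain k where "dtc_mass n \<mu> < real k * (c * \<epsilon>)"
      using reals_Archimedean3[of "c * \<epsilon>"] c \<epsilon> by (metis mult_pos_pos)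
    ultimately show False by (smt (verit))
  qed
  then obtain ms where ms: "P ms" "bad_mass n r ms < \<epsilon>" by blast
  then have "0 \<le> (\<Sum>m\<leftarrow>ms. dtc_mass n m)" by (intro sum_list_dtc_nonneg) (simp add: P_def)
  then show thesis using ms that[of ms] by (auto simp: P_def)
qed

text \<open>Repeated merging; this controls the information when all discarded pieces are fused into
  one.\<close>

lemma neg_ent_sum_list_le:
  fixes ms :: "((nat \<Rightarrow> 'a::finite) \<Rightarrow> real) list"
  assumes "\<forall>m\<in>set ms. nonneg_on n m"
  shows "neg_ent n (\<lambda>x. \<Sum>m\<leftarrow>ms. m x) \<le> (\<Sum>m\<leftarrow>ms. neg_ent n m)"
  using assms
proof (induction ms)
  case Nil
  then show ?case by (simp add: neg_ent_def)
next
  case (Cons m ms)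
  have "nonneg_on n (\<lambda>x. \<Sum>m\<leftarrow>ms. m x)"
    using Cons.prems by (auto simp: nonneg_on_def intro!: sum_list_nonneg)
  then have "neg_ent n (\<lambda>x. \<Sum>m\<leftarrow>m # ms. m x) \<le> neg_ent n m + neg_ent n (\<lambda>x. \<Sum>m\<leftarrow>ms. m x)"
    using Cons.prems by (intro neg_ent_add_le) auto
  then show ?case using Cons by simp
qed

section \<open>Translation back to fuzzy partitions\<close>

lemma transport_ineq_cong:
  assumes "\<And>x. x \<in> cube n \<Longrightarrow> \<mu> x = \<mu>' x"
  shows "transport_ineq n \<mu> \<kappa> r \<longleftrightarrow> transport_ineq n \<mu>' \<kappa> r"
proof -
  have "is_coupling n \<nu> \<mu> = is_coupling n \<nu> \<mu>'" for \<nu>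
    using assms by (auto simp: is_coupling_def fun_eq_iff)
  then have "dbar n \<nu> \<mu> = dbar n \<nu> \<mu>'" for \<nu> by (simp add: dbar_def)
  moreover have "abs_cont n \<nu> \<mu> = abs_cont n \<nu> \<mu>'" for \<nu> using assms by (auto simp: abs_cont_def)
  moreover have "KL n \<nu> \<mu> = KL n \<nu> \<mu>'" for \<nu> unfolding KL_def using assms by (intro sum.cong) auto
  ultimately show ?thesis by (simp add: transport_ineq_def)
qed

text \<open>The cube points agreeing with \<open>x\<close> off \<open>i\<close> are exactly the
  updates \<open>x(i := a)\<close>, one for each letter.\<close>

lemma marginal_eq_fibre_mass:
  fixes \<mu> :: "(nat \<Rightarrow> 'a::finite) \<Rightarrow> real"
  assumes x: "x \<in> cube n" and i: "i < n"
  shows "marginal n \<mu> ({..<n} - {i}) (restrict x ({..<n} - {i})) = fibre_mass i \<mu> x"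
proof -
  have "{y \<in> cube n. restrict y ({..<n} - {i}) = restrict x ({..<n} - {i})} = (\<lambda>a. x(i := a)) ` UNIV"
  proof (intro equalityI subsetI)
    fix y assume y: "y \<in> {y \<in> cube n. restrict y ({..<n} - {i}) = restrict x ({..<n} - {i})}"
    have "y k = x k" if "k < n" "k \<noteq> i" for k
      using y that by (auto simp: restrict_def fun_eq_iff dest!: spec[of _ k])
    then have "y = x(i := y i)" using y x i by (intro cube_eqI[of _ n]) (auto intro: fun_upd_in_cube)
    then show "y \<in> (\<lambda>a. x(i := a)) ` UNIV" by blast
  qed (use x i in \<open>auto intro: fun_upd_in_cube\<close>)
  moreover have "inj (\<lambda>a. x(i := a))" by (auto simp: inj_def fun_upd_eqD)
  ultimately show ?thesis by (simp add: marginal_def fibre_mass_def sum.reindex o_def)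
qed

lemma DTC_eq_dtc_mass:
  fixes \<mu> :: "(nat \<Rightarrow> 'a::finite) \<Rightarrow> real"
  assumes "is_prob n \<mu>"
  shows "DTC n \<mu> = dtc_mass n \<mu>"
proof -
  have "entropy n \<mu> = - neg_ent n \<mu>"
    using assms unfolding entropy_def neg_ent_def mass_def is_prob_def by (auto intro: sum.cong)
  moreover have "cond_entropy_coord n \<mu> i = - neg_cond_ent n i \<mu>" if "i < n" for i
    unfolding cond_entropy_coord_def neg_cond_ent_def
    using that by (auto simp: marginal_eq_fibre_mass intro!: sum.cong)
  ultimately show ?thesis by (simp add: DTC_def dtc_mass_def sum_negf)
qed

text \<open>Reconciles partition indices, which start at 1, with list positions, which start at
  0.\<close>

lemma sum_nth_pred: "(\<Sum>j\<in>{1..length l}. h (l ! (j - 1))) = (\<Sum>m\<leftarrow>l. h m)"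
proof -
  have "(\<Sum>j\<in>{1..length l}. h (l ! (j - 1))) = (\<Sum>j<length l. h (l ! j))"
    by (rule sum.reindex_bij_witness[of _ Suc "\<lambda>j. j - 1"]) auto
  then show ?thesis by (simp add: sum_list_sum_nth atLeast0LessThan)
qed

text \<open>The functions are the densities of the pieces with respect to \<open>\<mu>\<close>.
  Since the pieces sum to \<open>\<mu>\<close>, the terms in \<open>ln (\<mu> x)\<close> of the
  mutual information combine to \<open>neg_ent n \<mu>\<close>.\<close>

lemma fuzzy_partition_of_pieces:
  fixes \<mu> :: "(nat \<Rightarrow> 'a::finite) \<Rightarrow> real"
  assumes \<mu>: "is_prob n \<mu>" and l: "l \<noteq> []" "\<forall>m\<in>set l. nonneg_on n m" "\<And>x. (\<Sum>m\<leftarrow>l. m x) = \<mu> x"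
  obtains \<rho> where "fuzzy_partition n (length l) \<rho>"
    "mutual_info n \<mu> (length l) \<rho> = (\<Sum>m\<leftarrow>l. neg_ent n m) - neg_ent n \<mu>"
    "\<And>j x. j \<in> {1..length l} \<Longrightarrow> x \<in> cube n \<Longrightarrow> \<rho> j x * \<mu> x = (l ! (j - 1)) x"
proof -
  \<comment> \<open>Where \<open>\<mu>\<close> vanishes, the whole weight goes to index 1, so that
    the functions still sum to 1.\<close>
  define \<rho> where "\<rho> j x = (if \<mu> x = 0 then if j = 1 then 1 else 0 else (l ! (j - 1)) x / \<mu> x)" for j x
  let ?k = "length l"
  have nn: "0 \<le> (l ! (j - 1)) x" if "j \<in> {1..?k}" "x \<in> cube n" for j x
    using l(2) that nth_mem[of "j - 1" l] by (auto simp: nonneg_on_def)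
  have sum: "(\<Sum>j\<in>{1..?k}. (l ! (j - 1)) x) = \<mu> x" for x
    using sum_nth_pred[of "\<lambda>m. m x" l] l(3) by simp
  have le: "(l ! (j - 1)) x \<le> \<mu> x" if "j \<in> {1..?k}" "x \<in> cube n" for j x
    using member_le_sum[of j "{1..?k}" "\<lambda>j. (l ! (j - 1)) x"] that nn sum by auto
  have eq: "\<rho> j x * \<mu> x = (l ! (j - 1)) x" if "j \<in> {1..?k}" "x \<in> cube n" for j x
    using le[OF that] nn[OF that] by (simp add: \<rho>_def)
  have k: "1 \<le> ?k" using l(1) by (cases l) auto
  have one: "(\<Sum>j=1..?k. \<rho> j x) = 1" for x
  proof (cases "\<mu> x = 0")
    case True
    then show ?thesis using k by (simp add: \<rho>_def)
  next
    case False
    then show ?thesis using sum[of x] by (simp add: \<rho>_def flip: sum_divide_distrib)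
  qed
  have "fuzzy_partition n ?k \<rho>"
    unfolding fuzzy_partition_def
  proof (intro conjI ballI k one)
    fix j and x :: "nat \<Rightarrow> 'a" assume jx: "j \<in> {1..?k}" "x \<in> cube n"
    have "0 \<le> \<mu> x" using \<mu> jx by (simp add: is_prob_def)
    then show "0 \<le> \<rho> j x" "\<rho> j x \<le> 1" using nn[OF jx] le[OF jx] by (auto simp: \<rho>_def divide_le_eq_1)
  qed
  moreover have "mutual_info n \<mu> ?k \<rho> = (\<Sum>m\<leftarrow>l. neg_ent n m) - neg_ent n \<mu>"
  proof -
    have mass: "(\<Sum>y\<in>cube n. \<rho> j y * \<mu> y) = mass n (l ! (j - 1))" if "j \<in> {1..?k}" for j
      unfolding mass_def by (rule sum.cong) (use eq that in auto)
    have px: "(\<Sum>i\<in>{1..?k}. \<rho> i x * \<mu> x) = \<mu> x" for x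
      using one[of x] by (simp flip: sum_distrib_right)
    have "mutual_info n \<mu> ?k \<rho> = (\<Sum>j\<in>{1..?k}. \<Sum>x\<in>cube n.
        (l ! (j - 1)) x * ln ((l ! (j - 1)) x / mass n (l ! (j - 1))) - (l ! (j - 1)) x * ln (\<mu> x))"
      unfolding mutual_info_def Let_def px
    proof (intro sum.cong refl)
      fix j and x :: "nat \<Rightarrow> 'a" assume jx: "j \<in> {1..?k}" "x \<in> cube n"
      define m where "m = l ! (j - 1)"
      have m: "nonneg_on n m" using l(2) jx nth_mem[of "j - 1" l] by (auto simp: m_def)
      have "m x = 0 \<or> ln (m x / (mass n m * \<mu> x)) = ln (m x / mass n m) - ln (\<mu> x)"
      proof (cases "m x = 0")
        case False
        then have "0 < m x" using m jx by (auto simp: nonneg_on_def order_less_le)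
        moreover have "0 < mass n m" using mass_ge[OF m jx(2)] \<open>0 < m x\<close> by simp
        moreover have "0 < \<mu> x" using le[OF jx] \<open>0 < m x\<close> by (simp add: m_def)
        ultimately show ?thesis by (simp add: ln_div ln_mult)
      qed simp
      then show "(if \<rho> j x * \<mu> x = 0 then 0
            else \<rho> j x * \<mu> x * ln (\<rho> j x * \<mu> x / ((\<Sum>y\<in>cube n. \<rho> j y * \<mu> y) * \<mu> x)))
          = (l ! (j - 1)) x * ln ((l ! (j - 1)) x / mass n (l ! (j - 1))) - (l ! (j - 1)) x * ln (\<mu> x)"
        unfolding mass[OF jx(1)] eq[OF jx] m_def by (auto simp: right_diff_distrib)
    qed
    also have "\<dots> = (\<Sum>j\<in>{1..?k}. neg_ent n (l ! (j - 1))) - (\<Sum>j\<in>{1..?k}. \<Sum>x\<in>cube n. (l ! (j - 1)) x * ln (\<mu> x))"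
      by (simp add: neg_ent_def sum_subtractf)
    also have "(\<Sum>j\<in>{1..?k}. neg_ent n (l ! (j - 1))) = (\<Sum>m\<leftarrow>l. neg_ent n m)" by (rule sum_nth_pred)
    also have "(\<Sum>j\<in>{1..?k}. \<Sum>x\<in>cube n. (l ! (j - 1)) x * ln (\<mu> x)) = (\<Sum>x\<in>cube n. (\<Sum>j\<in>{1..?k}. (l ! (j - 1)) x) * ln (\<mu> x))"
      by (subst sum.swap) (simp only: sum_distrib_right)
    also have "\<dots> = neg_ent n \<mu>" using \<mu> unfolding sum by (simp add: neg_ent_def mass_def is_prob_def)
    finally show ?thesis .
  qed
  ultimately show thesis using that eq by blast
qed

theorem theorem6p1:
  fixes \<mu> :: "(nat \<Rightarrow> 'a::finite) \<Rightarrow> real" and n :: nat and \<epsilon> r :: real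
  assumes "0 < \<epsilon>" and "0 < r" and "is_prob n \<mu>"
  shows "\<exists>k \<rho>. fuzzy_partition n k \<rho> \<and>
           mutual_info n \<mu> k \<rho> \<le> 2 * DTC n \<mu> \<and>
           integ n \<mu> (\<rho> 1) < \<epsilon> \<and>
           (\<forall>j\<in>{2..k}. 0 < integ n \<mu> (\<rho> j) \<and>
              transport_ineq n (cond_meas n \<mu> (\<rho> j)) (r * real n / 200) r)"
proof -
  have "nonneg_on n \<mu>" using assms(3) by (simp add: is_prob_def nonneg_on_def)
  from pieces_with_small_bad_mass[OF assms(2,1) this] obtain ms where
    ms: "\<forall>m\<in>set ms. nonneg_on n m" "\<And>x. (\<Sum>m\<leftarrow>ms. m x) = \<mu> x"
    "(\<Sum>m\<leftarrow>ms. neg_ent n m) - neg_ent n \<mu> \<le> 2 * dtc_mass n \<mu>" "bad_mass n r ms < \<epsilon>" by blast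
  define good where "good m \<longleftrightarrow> 0 < mass n m \<and> \<not> bad_piece n r m" for m :: "(nat \<Rightarrow> 'a) \<Rightarrow> real"
  define gs where "gs = filter good ms"
  define bs where "bs = filter (\<lambda>m. \<not> good m) ms"
  \<comment> \<open>The future first piece. The null pieces in \<open>bs\<close> add nothing, so its
    mass equals the bad mass.\<close>
  define rest where "rest = (\<lambda>x. \<Sum>m\<leftarrow>bs. m x)"
  have split: "(\<Sum>m\<leftarrow>bs. h m) + (\<Sum>m\<leftarrow>gs. h m) = (\<Sum>m\<leftarrow>ms. h m)" for h :: "((nat \<Rightarrow> 'a) \<Rightarrow> real) \<Rightarrow> real"
    unfolding bs_def gs_def by (induction ms) auto
  have "mass n rest = (\<Sum>m\<leftarrow>bs. mass n m)"
    unfolding rest_def mass_def by (induction bs) (auto simp: sum.distrib)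
  also have "\<dots> = bad_mass n r ms"
    using ms(1) unfolding bs_def bad_mass_def
  proof (induction ms)
    case (Cons m ms)
    then show ?case using mass_nonneg[of n m] by (auto simp: good_def bad_piece_def)
  qed simp
  finally have rest_mass: "mass n rest < \<epsilon>" using ms(4) by simp
  have nonneg: "\<forall>m\<in>set (rest # gs). nonneg_on n m"
    using ms(1) by (auto simp: rest_def bs_def gs_def nonneg_on_def intro!: sum_list_nonneg)
  have sum: "(\<Sum>m\<leftarrow>rest # gs. m x) = \<mu> x" for x
    using split[of "\<lambda>m. m x"] ms(2) by (simp add: rest_def)
  have "neg_ent n rest \<le> (\<Sum>m\<leftarrow>bs. neg_ent n m)"
    unfolding rest_def using ms(1) by (intro neg_ent_sum_list_le) (auto simp: bs_def)
  then have ent: "(\<Sum>m\<leftarrow>rest # gs. neg_ent n m) - neg_ent n \<mu> \<le> 2 * DTC n \<mu>"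
    using ms(3) split[of "neg_ent n"] by (simp add: DTC_eq_dtc_mass[OF assms(3)])
  obtain \<rho> where \<rho>: "fuzzy_partition n (length (rest # gs)) \<rho>"
    "mutual_info n \<mu> (length (rest # gs)) \<rho> = (\<Sum>m\<leftarrow>rest # gs. neg_ent n m) - neg_ent n \<mu>"
    and eq: "\<And>j x. j \<in> {1..length (rest # gs)} \<Longrightarrow> x \<in> cube n \<Longrightarrow> \<rho> j x * \<mu> x = ((rest # gs) ! (j - 1)) x"
    using fuzzy_partition_of_pieces[OF assms(3) _ nonneg sum] by blast
  have integ: "integ n \<mu> (\<rho> j) = mass n ((rest # gs) ! (j - 1))" if "j \<in> {1..length (rest # gs)}" for j
    unfolding integ_def mass_def by (rule sum.cong) (use eq that in auto)
  show ?thesis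
  proof (intro exI[of _ "length (rest # gs)"] exI[of _ \<rho>] conjI ballI)
    show "integ n \<mu> (\<rho> 1) < \<epsilon>" using rest_mass by (subst integ) auto
    fix j assume j: "j \<in> {2..length (rest # gs)}"
    then have j1: "j \<in> {1..length (rest # gs)}" by simp
    define m where "m = (rest # gs) ! (j - 1)"
    \<comment> \<open>One shift for the 1-based index and one for \<open>rest\<close> at the head of
      the list.\<close>
    have "m = gs ! (j - 2)" using j by (auto simp: m_def nth_Cons' numeral_2_eq_2)
    then have "m \<in> set gs" using j by (auto simp: in_set_conv_nth intro!: exI[of _ "j - 2"])
    then have m: "0 < mass n m" "transport_ineq n (\<lambda>x. m x / mass n m) (r * real n / 200) r"
      by (auto simp: gs_def good_def bad_piece_def)
    show "0 < integ n \<mu> (\<rho> j)" using m(1) integ[OF j1] by (simp add: m_def)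
    show "transport_ineq n (cond_meas n \<mu> (\<rho> j)) (r * real n / 200) r"
      using m(2) by (subst transport_ineq_cong[of n _ "\<lambda>x. m x / mass n m"])
        (auto simp: cond_meas_def integ[OF j1] eq[OF j1] m_def simp del: nth_Cons_pos)
  qed (use \<rho> ent in auto)
qed

end
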